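(* Let $\mathcal{Z}\subset\mathbb{R}^n$ be closed, $f:\mathbb{R}^n\times\mathcal{Z}\to\mathbb{R}^n$ continuous, and $G:\mathcal{Z}\to\mathbb{S}^n_+$ a continuous metric. Let $z_0\in\mathcal{Z}$ and let $M,\nu,\mu,\alpha,\epsilon>0$ be such that $\|f(z,P_\mathcal{Z}(z))\|\le M$ and $\mu\mathbb{I}\preceq G^{-1}(P_\mathcal{Z}(z))\preceq\nu\mathbb{I}$ for all $z\in(z_0+\epsilon\mathbb{B})\cap\mathcal{Z}^\circ_\alpha$, and $\mathcal{Z}$ is $\alpha$-prox-regular at every $z\in(z_0+\epsilon\mathbb{B})\cap\mathcal{Z}$. Given any $T>0$, consider a sequence $K_n\to0^+$ and let $\{z_n\}$ be a sequence such that each $z_n$ is a $(T,\epsilon)$-truncated solution of the anti-windup approximation $$\dot z\in F_{K_n}(z):=f(z,P_\mathcal{Z}(z))-\tfrac{1}{K_n}G^{-1}(P_\mathcal{Z}(z))\big(z-P_\mathcal{Z}(z)\big)$$ with $z_n(0)=z_0$. Then there exists a subsequence of $\{z_n\}$ that converges graphically to a $(T,\epsilon)$-truncated solution of the projected dynamical system $\dot z=\Pi^G_\mathcal{Z}[\hat f](z)$, $z\in\mathcal{Z}$, where $\hat f(z):=f(z,P_\mathcal{Z}(z))$.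
   Context: $\mathbb{B}$ ($\operatorname{int}\mathbb{B}$) is the closed (open) unit ball; $\mathbb{S}^n_+$ is the set of symmetric positive definite $n\times n$ matrices; $\|u\|_{G(x)}:=(u^TG(x)u)^{1/2}$. $P_\mathcal{Z}(z):=\{\tilde z\in\mathcal{Z}:\|z-\tilde z\|=\inf_{y\in\mathcal{Z}}\|z-y\|\}$ (possibly set-valued); expressions containing $P_\mathcal{Z}(z)$ are understood as the sets obtained by ranging over $p\in P_\mathcal{Z}(z)$. $\mathcal{Z}^\circ_\alpha:=\mathcal{Z}+\tfrac{1}{2\alpha}\operatorname{int}\mathbb{B}$. Sets are assumed Clarke regular wherever tangent/normal cones are used. Tangent cone: $v\in T_x\mathcal{Z}$ iff there are $x_k\to x$, $x_k\in\mathcal{Z}$, $\delta_k\to0^+$ with $(x_k-x)/\delta_k\to v$; $\mathcal{Z}$ is Clarke regular if $x\mapsto T_x\mathcal{Z}$ is inner semicontinuous, and then the normal cone is $N_x\mathcal{Z}:=\{\eta:\langle\eta,v\rangle\le0\ \forall v\in T_x\mathcal{Z}\}$. $\mathcal{Z}$ is $\alpha$-prox-regular at $x\in\mathcal{Z}$ if every $\eta\in N_x\mathcal{Z}$ satisfies $\langle\eta,y-x\rangle\le\alpha\|\eta\|\|y-x\|^2$ for all $y\in\mathcal{Z}$. The projection operator is $\Pi^G_\mathcal{Z}[w](x):=\arg\min_{v\in T_x\mathcal{Z}}\|v-w\|_{G(x)}$ for $x\in\mathcal{Z}$, and $\Pi^G_\mathcal{Z}[\hat f](x):=\Pi^G_\mathcal{Z}[\hat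 f(x)](x)$. Solutions are Carathéodory: absolutely continuous maps satisfying the inclusion (and, for the projected system, $z(t)\in\mathcal{Z}$) for almost all $t$. A solution $x:[0,T']\to\mathbb{R}^n$ with $x(0)=x_0$ is $(T,\epsilon)$-truncated if $x(t)\in x_0+\epsilon\mathbb{B}$ for all $t\in[0,T']$ and either $T'=T$ or $\|x(T')-x_0\|=\epsilon$. A sequence of maps $z_i:[0,T_i]\to\mathbb{R}^n$ converges graphically if their graphs $\{(t,z_i(t))\}\subset\mathbb{R}\times\mathbb{R}^n$ converge as sets in the Painlevé–Kuratowski sense; the limit is the map whose graph is the limit set. *)

theory Defs
  imports "HOL-Analysis.Analysis"
begin

definition proj_set :: "(real^'n) set \<Rightarrow> real^'n \<Rightarrow> (real^'n) set" where
  "proj_set Z z = {p \<in> Z. dist z p = (INF y\<in>Z. dist z y)}"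

definition inflated :: "(real^'n) set \<Rightarrow> real \<Rightarrow> (real^'n) set" where
  "inflated Z \<alpha> = {y + w | y w. y \<in> Z \<and> w \<in> ball 0 (1 / (2 * \<alpha>))}"

definition tangent_cone :: "(real^'n) set \<Rightarrow> real^'n \<Rightarrow> (real^'n) set" where
  "tangent_cone Z x = {v. \<exists>xs \<delta>. (\<forall>k. xs k \<in> Z) \<and> xs \<longlonglongrightarrow> x \<and>
      (\<forall>k. \<delta> k > 0) \<and> \<delta> \<longlonglongrightarrow> 0 \<and> (\<lambda>k. (1 / \<delta> k) *\<^sub>R (xs k - x)) \<longlonglongrightarrow> v}"

definition clarke_regular :: "(real^'n) set \<Rightarrow> bool" where
  "clarke_regular Z \<longleftrightarrow> (\<forall>x\<in>Z. \<forall>v\<in>tangent_cone Z x. \<forall>xs. (\<forall>k. xs k \<in> Z) \<and> xs \<longlonglongrightarrow> x \<longrightarrow>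
      (\<exists>vs. (\<forall>k. vs k \<in> tangent_cone Z (xs k)) \<and> vs \<longlonglongrightarrow> v))"

definition normal_cone :: "(real^'n) set \<Rightarrow> real^'n \<Rightarrow> (real^'n) set" where
  "normal_cone Z x = {\<eta>. \<forall>v\<in>tangent_cone Z x. \<eta> \<bullet> v \<le> 0}"

definition prox_regular_at :: "(real^'n) set \<Rightarrow> real \<Rightarrow> real^'n \<Rightarrow> bool" where
  "prox_regular_at Z \<alpha> x \<longleftrightarrow> x \<in> Z \<and>
     (\<forall>\<eta>\<in>normal_cone Z x. \<forall>y\<in>Z. \<eta> \<bullet> (y - x) \<le> \<alpha> * norm \<eta> * (norm (y - x))\<^sup>2)"

definition sym_pos_def :: "real^'n^'n \<Rightarrow> bool" where
  "sym_pos_def A \<longleftrightarrow> transpose A = A \<and> (\<forall>u. u \<noteq> 0 \<longrightarrow> u \<bullet> (A *v u) > 0)"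

definition loewner_le :: "real^'n^'n \<Rightarrow> real^'n^'n \<Rightarrow> bool" where
  "loewner_le A B \<longleftrightarrow> (\<forall>u. u \<bullet> (A *v u) \<le> u \<bullet> (B *v u))"

definition Gnorm :: "real^'n^'n \<Rightarrow> real^'n \<Rightarrow> real" where
  "Gnorm A u = sqrt (u \<bullet> (A *v u))"

definition proj_op :: "(real^'n) set \<Rightarrow> (real^'n \<Rightarrow> real^'n^'n) \<Rightarrow> real^'n \<Rightarrow> real^'n \<Rightarrow> (real^'n) set" where
  "proj_op Z G w x = {v \<in> tangent_cone Z x.
      \<forall>v'\<in>tangent_cone Z x. Gnorm (G x) (v - w) \<le> Gnorm (G x) (v' - w)}"

definition abs_continuous_on_interval :: "real \<Rightarrow> real \<Rightarrow> (real \<Rightarrow> real^'n) \<Rightarrow> bool" where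
  "abs_continuous_on_interval a b z \<longleftrightarrow>
    (\<forall>e>0. \<exists>d>0. \<forall>(N::nat) (l::nat \<Rightarrow> real) u.
       (\<forall>i<N. a \<le> l i \<and> l i \<le> u i \<and> u i \<le> b) \<and>
       (\<forall>i<N. \<forall>j<N. i \<noteq> j \<longrightarrow> u i \<le> l j \<or> u j \<le> l i) \<and>
       (\<Sum>i<N. u i - l i) < d \<longrightarrow> (\<Sum>i<N. norm (z (u i) - z (l i))) < e)"

definition caratheodory_sol :: "(real^'n \<Rightarrow> (real^'n) set) \<Rightarrow> real \<Rightarrow> (real \<Rightarrow> real^'n) \<Rightarrow> bool" where
  "caratheodory_sol F T' z \<longleftrightarrow> 0 \<le> T' \<and> abs_continuous_on_interval 0 T' z \<and>
     (AE t in lborel. t \<in> {0..T'} \<longrightarrow>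
        (\<exists>v. (z has_vector_derivative v) (at t within {0..T'}) \<and> v \<in> F (z t)))"

definition truncated_sol :: "(real^'n \<Rightarrow> (real^'n) set) \<Rightarrow> real \<Rightarrow> real \<Rightarrow> real^'n \<Rightarrow> real \<Rightarrow> (real \<Rightarrow> real^'n) \<Rightarrow> bool" where
  "truncated_sol F T \<epsilon> x0 T' z \<longleftrightarrow> caratheodory_sol F T' z \<and> z 0 = x0 \<and> T' \<le> T \<and>
     (\<forall>t\<in>{0..T'}. z t \<in> cball x0 \<epsilon>) \<and> (T' = T \<or> norm (z T' - x0) = \<epsilon>)"

definition anti_windup :: "(real^'n) set \<Rightarrow> (real^'n \<Rightarrow> real^'n \<Rightarrow> real^'n) \<Rightarrow> (real^'n \<Rightarrow> real^'n^'n)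
    \<Rightarrow> real \<Rightarrow> real^'n \<Rightarrow> (real^'n) set" where
  "anti_windup Z f G K z =
     {f z p - (1 / K) *\<^sub>R (matrix_inv (G p) *v (z - p)) | p. p \<in> proj_set Z z}"

definition pds_rhs :: "(real^'n) set \<Rightarrow> (real^'n \<Rightarrow> real^'n \<Rightarrow> real^'n) \<Rightarrow> (real^'n \<Rightarrow> real^'n^'n)
    \<Rightarrow> real^'n \<Rightarrow> (real^'n) set" where
  "pds_rhs Z f G z = {v. z \<in> Z \<and> (\<exists>p\<in>proj_set Z z. v \<in> proj_op Z G (f z p) z)}"

definition graph_of :: "real \<Rightarrow> (real \<Rightarrow> real^'n) \<Rightarrow> (real \<times> (real^'n)) set" where
  "graph_of T' z = {(t, z t) | t. t \<in> {0..T'}}"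

definition inner_limit :: "(nat \<Rightarrow> ('a::metric_space) set) \<Rightarrow> 'a set" where
  "inner_limit S = {x. \<exists>xs. (\<forall>\<^sub>F i in sequentially. xs i \<in> S i) \<and> xs \<longlonglongrightarrow> x}"

definition outer_limit :: "(nat \<Rightarrow> ('a::metric_space) set) \<Rightarrow> 'a set" where
  "outer_limit S = {x. \<exists>r xs. strict_mono r \<and> (\<forall>k. xs k \<in> S (r k)) \<and> xs \<longlonglongrightarrow> x}"

definition PK_converges :: "(nat \<Rightarrow> ('a::metric_space) set) \<Rightarrow> 'a set \<Rightarrow> bool" where
  "PK_converges S L \<longleftrightarrow> outer_limit S \<subseteq> L \<and> L \<subseteq> inner_limit S"

definition graph_converges :: "(nat \<Rightarrow> real) \<Rightarrow> (nat \<Rightarrow> real \<Rightarrow> real^'n) \<Rightarrow> real \<Rightarrow> (real \<Rightarrow> real^'n) \<Rightarrow> bool" where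
  "graph_converges Ts zs T' z \<longleftrightarrow> PK_converges (\<lambda>i. graph_of (Ts i) (zs i)) (graph_of T' z)"

end

theory Submission
  imports Defs "HOL-Complex_Analysis.Great_Picard"
begin

text \<open>The squared distance of a trajectory to \<open>Z\<close> has right derivative at most
  \<open>2 d (M - (\<mu> / K) d)\<close>, so \<open>d \<le> K M / \<mu>\<close>. Hence the correction terms \<open>(z - p) / K\<close> are bounded, the
  trajectories are uniformly Lipschitz, and Arzela--Ascoli gives a uniform limit in \<open>Z\<close>, which is
  differentiable almost everywhere. The correction terms are proximal normals at nearby points of
  \<open>Z\<close>, so by Clarke regularity \<open>G(x) (f(x, x) - v)\<close> is normal at \<open>x\<close> for a limit velocity \<open>v\<close>. As
  \<open>v\<close> and \<open>- v\<close> are both tangent, \<open>v\<close> is the projection of \<open>f(x, x)\<close>.\<close>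

section \<open>Absolutely continuous functions\<close>

text \<open>Velocities exist only almost everywhere, and the distance to \<open>Z\<close> need not
  be differentiable along a trajectory, because projections may be set-valued. It does have an upper
  model: with \<open>p\<close> one projection of \<open>z t\<close>, the distance from
  \<open>z s\<close> to \<open>p\<close> dominates the distance to \<open>Z\<close> and agrees with
  it at \<open>s = t\<close>. This controls right difference quotients from above and nothing else,
  so the estimates on trajectories pass through one increment inequality for right slopes, applied
  to a truncated squared distance and to \<open>u \<bullet> z\<close> for fixed \<open>u\<close>.

  The bounds on \<open>f\<close> and \<open>G\<close> hold only within distance
  \<open>1 / (2 * \<alpha>)\<close> of \<open>Z\<close>, so the distance estimate must itself prove
  that the trajectory stays in that tube. The threshold \<open>K * M / \<mu>\<close> is the zero of
  \<open>M - (\<mu> / K) d\<close>.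

  In the limit, velocities need not converge. Pairing \<open>f z p - v\<close> with
  \<open>G p *v w\<close> cancels the inverse metric and leaves
  \<open>(z - p) \<bullet> w / K\<close>. The resulting inequality is affine in \<open>v\<close>, so
  it survives integration, and only positions have to converge.\<close>

lemma abs_continuous_on_intervalE:
  assumes "abs_continuous_on_interval a b z" "0 < e"
  obtains d where "d > 0" "\<And>(N::nat) (l::nat \<Rightarrow> real) u. \<forall>i<N. a \<le> l i \<and> l i \<le> u i \<and> u i \<le> b \<Longrightarrow>
       \<forall>i<N. \<forall>j<N. i \<noteq> j \<longrightarrow> u i \<le> l j \<or> u j \<le> l i \<Longrightarrow>
       (\<Sum>i<N. u i - l i) < d \<Longrightarrow> (\<Sum>i<N. norm (z (u i) - z (l i))) < e"
proof -
  from assms(1)[unfolded abs_continuous_on_interval_def, rule_format, OF assms(2)]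
  obtain d where d: "d > 0" "\<forall>(N::nat) (l::nat \<Rightarrow> real) u.
       (\<forall>i<N. a \<le> l i \<and> l i \<le> u i \<and> u i \<le> b) \<and>
       (\<forall>i<N. \<forall>j<N. i \<noteq> j \<longrightarrow> u i \<le> l j \<or> u j \<le> l i) \<and>
       (\<Sum>i<N. u i - l i) < d \<longrightarrow> (\<Sum>i<N. norm (z (u i) - z (l i))) < e" by (elim exE conjE)
  show thesis
  proof (rule that[OF d(1)])
    fix N :: nat and l u :: "nat \<Rightarrow> real"
    assume "\<forall>i<N. a \<le> l i \<and> l i \<le> u i \<and> u i \<le> b"
      "\<forall>i<N. \<forall>j<N. i \<noteq> j \<longrightarrow> u i \<le> l j \<or> u j \<le> l i" "(\<Sum>i<N. u i - l i) < d"
    with d(2)[THEN spec, of N, THEN spec, of l, THEN spec, of u]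
    show "(\<Sum>i<N. norm (z (u i) - z (l i))) < e" by simp
  qed
qed

lemma abs_continuous_on_interval_subinterval:
  assumes "abs_continuous_on_interval a b z" "a \<le> a'" "b' \<le> b"
  shows "abs_continuous_on_interval a' b' z"
  unfolding abs_continuous_on_interval_def
proof (intro allI impI)
  fix e :: real assume "e > 0"
  obtain d where d: "d > 0" "\<And>(N::nat) (l::nat \<Rightarrow> real) u.
       \<forall>i<N. a \<le> l i \<and> l i \<le> u i \<and> u i \<le> b \<Longrightarrow>
       \<forall>i<N. \<forall>j<N. i \<noteq> j \<longrightarrow> u i \<le> l j \<or> u j \<le> l i \<Longrightarrow>
       (\<Sum>i<N. u i - l i) < d \<Longrightarrow> (\<Sum>i<N. norm (z (u i) - z (l i))) < e"
  proof (rule abs_continuous_on_intervalE[OF assms(1) \<open>e > 0\<close>], goal_cases)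
    case (1 d)
    show thesis by (rule that[OF 1(2)]) (rule 1(3); assumption)
  qed
  show "\<exists>d>0. \<forall>(N::nat) (l::nat \<Rightarrow> real) u.
       (\<forall>i<N. a' \<le> l i \<and> l i \<le> u i \<and> u i \<le> b') \<and>
       (\<forall>i<N. \<forall>j<N. i \<noteq> j \<longrightarrow> u i \<le> l j \<or> u j \<le> l i) \<and>
       (\<Sum>i<N. u i - l i) < d \<longrightarrow> (\<Sum>i<N. norm (z (u i) - z (l i))) < e"
  proof (intro exI[of _ d] conjI allI impI d(1), elim conjE)
    fix N :: nat and l u :: "nat \<Rightarrow> real"
    assume *: "\<forall>i<N. a' \<le> l i \<and> l i \<le> u i \<and> u i \<le> b'"
      "\<forall>i<N. \<forall>j<N. i \<noteq> j \<longrightarrow> u i \<le> l j \<or> u j \<le> l i" "(\<Sum>i<N. u i - l i) < d"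
    show "(\<Sum>i<N. norm (z (u i) - z (l i))) < e"
    proof (rule d(2)[OF _ *(2,3)])
      show "\<forall>i<N. a \<le> l i \<and> l i \<le> u i \<and> u i \<le> b"
        using *(1) assms(2,3) by (meson order_trans)
    qed
  qed
qed

lemma abs_continuous_on_interval_imp_continuous_on:
  assumes "abs_continuous_on_interval a b z"
  shows "continuous_on {a..b} z"
  unfolding continuous_on_iff
proof (intro ballI allI impI)
  fix x e :: real assume x: "x \<in> {a..b}" and "e > 0"
  obtain d where d: "d > 0" "\<And>(N::nat) (l::nat \<Rightarrow> real) u.
       \<forall>i<N. a \<le> l i \<and> l i \<le> u i \<and> u i \<le> b \<Longrightarrow>
       \<forall>i<N. \<forall>j<N. i \<noteq> j \<longrightarrow> u i \<le> l j \<or> u j \<le> l i \<Longrightarrow>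
       (\<Sum>i<N. u i - l i) < d \<Longrightarrow> (\<Sum>i<N. norm (z (u i) - z (l i))) < e"
  proof (rule abs_continuous_on_intervalE[OF assms(1) \<open>e > 0\<close>], goal_cases)
    case (1 d)
    show thesis by (rule that[OF 1(2)]) (rule 1(3); assumption)
  qed
  have "dist (z y) (z x) < e" if "y \<in> {a..b}" "dist y x < d" for y
    using d(2)[of 1 "\<lambda>_. min x y" "\<lambda>_. max x y"] that x
    by (cases "x \<le> y") (auto simp: dist_norm norm_minus_commute)
  with d(1) show "\<exists>d>0. \<forall>y\<in>{a..b}. dist y x < d \<longrightarrow> dist (z y) (z x) < e" by blast
qed

lemma lipschitz_imp_abs_continuous_on_interval:
  assumes lip: "\<And>s t. a \<le> s \<Longrightarrow> s \<le> t \<Longrightarrow> t \<le> b \<Longrightarrow> norm (z t - z s) \<le> L * (t - s)"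
  shows "abs_continuous_on_interval a b z"
  unfolding abs_continuous_on_interval_def
proof (intro allI impI)
  fix e :: real assume e: "e > 0"
  define B where "B = \<bar>L\<bar> + 1"
  have B: "B > 0" "L \<le> B" by (auto simp: B_def)
  have "(\<Sum>i<N. norm (z (u i) - z (l i))) < e"
    if *: "\<forall>i<N. a \<le> l i \<and> l i \<le> u i \<and> u i \<le> b" and s: "(\<Sum>i<N. u i - l i) < e / B"
    for N :: nat and l u :: "nat \<Rightarrow> real"
  proof -
    have "(\<Sum>i<N. norm (z (u i) - z (l i))) \<le> (\<Sum>i<N. B * (u i - l i))"
    proof (rule sum_mono)
      fix i assume i: "i \<in> {..<N}"
      then have "norm (z (u i) - z (l i)) \<le> L * (u i - l i)" using * by (intro lip) auto
      also have "\<dots> \<le> B * (u i - l i)" using B * i by (intro mult_right_mono) auto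
      finally show "norm (z (u i) - z (l i)) \<le> B * (u i - l i)" .
    qed
    also have "\<dots> = B * (\<Sum>i<N. u i - l i)" by (simp add: sum_distrib_left)
    also have "\<dots> < B * (e / B)" using s B by (intro mult_strict_left_mono) auto
    also have "\<dots> = e" using B by simp
    finally show ?thesis .
  qed
  with e B show "\<exists>d>0. \<forall>(N::nat) (l::nat \<Rightarrow> real) u.
       (\<forall>i<N. a \<le> l i \<and> l i \<le> u i \<and> u i \<le> b) \<and>
       (\<forall>i<N. \<forall>j<N. i \<noteq> j \<longrightarrow> u i \<le> l j \<or> u j \<le> l i) \<and>
       (\<Sum>i<N. u i - l i) < d \<longrightarrow> (\<Sum>i<N. norm (z (u i) - z (l i))) < e"
    by (intro exI[of _ "e / B"]) auto
qed

text \<open>Nonoverlapping closed intervals may share endpoints. Their interiors are disjoint and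
  have the same lengths, so additivity is applied to those.\<close>

lemma sum_lengths_le_emeasure:
  fixes l u :: "nat \<Rightarrow> real" and U :: "real set"
  assumes "\<forall>i<N. l i \<le> u i \<and> {l i..u i} \<subseteq> U"
    and "\<forall>i<N. \<forall>j<N. i \<noteq> j \<longrightarrow> u i \<le> l j \<or> u j \<le> l i" and "U \<in> sets borel"
  shows "ennreal (\<Sum>i<N. u i - l i) \<le> emeasure lborel U"
proof -
  have "ennreal (\<Sum>i<N. u i - l i) = (\<Sum>i<N. ennreal (u i - l i))"
    using assms by (subst sum_ennreal) auto
  also have "\<dots> = (\<Sum>i<N. emeasure lborel {l i<..<u i})"
    using assms by (intro sum.cong) auto
  also have "\<dots> = emeasure lborel (\<Union>i\<in>{..<N}. {l i<..<u i})"
  proof (rule sum_emeasure)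
    show "disjoint_family_on (\<lambda>i. {l i<..<u i}) {..<N}"
      unfolding disjoint_family_on_def
    proof (intro ballI impI)
      fix m n assume "m \<in> {..<N}" "n \<in> {..<N}" "m \<noteq> n"
      then have "u m \<le> l n \<or> u n \<le> l m" using assms(2) by simp
      then show "{l m<..<u m} \<inter> {l n<..<u n} = {}" by auto
    qed
  qed auto
  also have "\<dots> \<le> emeasure lborel U"
    using assms by (intro emeasure_mono) (force simp: subset_iff)+
  finally show ?thesis .
qed

text \<open>Only right difference quotients are controlled, so a covering by tagged intervals is not
  available. Instead the increment over \<open>[a, t]\<close> is compared with
  \<open>(c + e) (t - a)\<close> plus the variation of \<open>z\<close> inside a small open cover of the exceptional set,
  and the set of good \<open>t\<close> is both closed under increasing limits and extendable to the right.\<close>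
lemma abs_continuous_increment_le:
  fixes z :: "real \<Rightarrow> real^'n" and g :: "real \<Rightarrow> real"
  assumes ac: "abs_continuous_on_interval a b z" and ab: "a \<le> b" and C: "C \<ge> 0"
    and dom: "\<And>s t. a \<le> s \<Longrightarrow> s \<le> t \<Longrightarrow> t \<le> b \<Longrightarrow> \<bar>g t - g s\<bar> \<le> C * norm (z t - z s)"
    and slope: "AE t in lborel. a \<le> t \<and> t < b \<longrightarrow>
        (\<forall>e>0. \<exists>d>0. \<forall>v. t < v \<and> v < t + d \<and> v \<le> b \<longrightarrow> g v - g t \<le> (c + e) * (v - t))"
  shows "g b - g a \<le> c * (b - a)"
proof (rule field_le_epsilon)
  fix e0 :: real assume e0: "e0 > 0"
  \<comment> \<open>The error budget: slope excess \<open>e\<close> over length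
    \<open>b - a\<close>, plus at most \<open>(C + \<bar>c\<bar>) * e\<close> from the cover; the
    extra 1 keeps the divisor positive.\<close>
  define e where "e = e0 / ((b - a) + C + \<bar>c\<bar> + 1)"
  have den: "(b - a) + C + \<bar>c\<bar> + 1 > 0" using ab C by simp
  have e: "e > 0" using e0 den by (simp add: e_def)
  obtain d0 where d0: "d0 > 0" "\<And>(N::nat) (l::nat \<Rightarrow> real) u.
       \<forall>i<N. a \<le> l i \<and> l i \<le> u i \<and> u i \<le> b \<Longrightarrow>
       \<forall>i<N. \<forall>j<N. i \<noteq> j \<longrightarrow> u i \<le> l j \<or> u j \<le> l i \<Longrightarrow>
       (\<Sum>i<N. u i - l i) < d0 \<Longrightarrow> (\<Sum>i<N. norm (z (u i) - z (l i))) < e"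
  proof (rule abs_continuous_on_intervalE[OF ac e], goal_cases)
    case (1 d)
    show thesis by (rule that[OF 1(2)]) (rule 1(3); assumption)
  qed
  define d where "d = min d0 e"
  have d: "d > 0" "d \<le> d0" "d \<le> e" using d0 e by (auto simp: d_def)
  define good where "good t \<longleftrightarrow> (\<forall>e>0. \<exists>d>0. \<forall>v. t < v \<and> v < t + d \<and> v \<le> b \<longrightarrow>
      g v - g t \<le> (c + e) * (v - t))" for t
  obtain X where X: "{t. \<not> (a \<le> t \<and> t < b \<longrightarrow> good t)} \<subseteq> X" "X \<in> null_sets lborel"
    using slope unfolding good_def by (auto elim!: AE_E simp: null_sets_def)
  obtain U where U: "open U" "X \<subseteq> U" "emeasure lborel (U - X) < d"
    using outer_regular_lborel[of X d] X d by (auto simp: null_sets_def)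
  have eU: "emeasure lborel U < d"
  proof -
    have "emeasure lborel (U - X) = emeasure lborel U"
      using X(2) U(1) by (intro emeasure_Diff_null_set) auto
    with U(3) show ?thesis by simp
  qed
  define fam where "fam t N l u \<longleftrightarrow> (\<forall>i<N. a \<le> l i \<and> l i \<le> u i \<and> u i \<le> t \<and> {l i..u i} \<subseteq> U) \<and>
      (\<forall>i<N. \<forall>j<N. i \<noteq> j \<longrightarrow> u i \<le> l j \<or> u j \<le> l i)" for t and N :: nat and l u :: "nat \<Rightarrow> real"
  \<comment> \<open>Inside \<open>U\<close> only \<open>dom\<close> is available. The term
    \<open>\<bar>c\<bar> * (t - s)\<close> compensates for the target slope \<open>c + e\<close>,
    which may be negative.\<close>
  define w where "w s t = C * norm (z t - z s) + \<bar>c\<bar> * (t - s)" for s t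
  define S where "S t = {x. \<exists>N l u. fam t N l u \<and> x = (\<Sum>i<N. w (l i) (u i))}" for t
  define W where "W t = Sup (S t)" for t
  have S_le: "x \<le> (C + \<bar>c\<bar>) * e" if xS: "x \<in> S t" and "t \<le> b" for x t
  proof -
    obtain N l u where f: "fam t N l u" and x: "x = (\<Sum>i<N. w (l i) (u i))"
      using xS unfolding S_def mem_Collect_eq by (elim exE conjE)
    have "ennreal (\<Sum>i<N. u i - l i) \<le> emeasure lborel U"
      using f U(1) by (intro sum_lengths_le_emeasure) (auto simp: fam_def)
    with eU have "ennreal (\<Sum>i<N. u i - l i) < ennreal d" by (metis le_less_trans)
    moreover have "0 \<le> (\<Sum>i<N. u i - l i)" using f unfolding fam_def by (intro sum_nonneg) auto
    ultimately have len: "(\<Sum>i<N. u i - l i) < d" by (simp add: ennreal_less_iff)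
    moreover have "\<forall>i<N. a \<le> l i \<and> l i \<le> u i \<and> u i \<le> b"
      using f that(2) unfolding fam_def by (meson order_trans)
    ultimately have "(\<Sum>i<N. norm (z (u i) - z (l i))) < e"
      using f d(2) by (intro d0(2)[of N l u]) (auto simp: fam_def)
    then have "C * (\<Sum>i<N. norm (z (u i) - z (l i))) + \<bar>c\<bar> * (\<Sum>i<N. u i - l i) \<le> C * e + \<bar>c\<bar> * e"
      using C len d(3) by (intro add_mono mult_left_mono) auto
    moreover have "x = C * (\<Sum>i<N. norm (z (u i) - z (l i))) + \<bar>c\<bar> * (\<Sum>i<N. u i - l i)"
      by (simp add: x w_def sum.distrib sum_distrib_left)
    ultimately show ?thesis by (simp add: algebra_simps)
  qed
  have S0: "0 \<in> S t" for t
    unfolding S_def fam_def by (auto intro!: exI[of _ "0::nat"])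
  have bdd: "bdd_above (S t)" if "t \<le> b" for t unfolding bdd_above_def using S_le that by blast
  have W_le: "W b \<le> (C + \<bar>c\<bar>) * e" unfolding W_def using S_le S0 by (intro cSup_least) auto
  have W_mono: "W s \<le> W t" if "s \<le> t" "t \<le> b" for s t
    unfolding W_def
  proof (rule cSup_subset_mono)
    show "S s \<subseteq> S t" using that unfolding S_def fam_def by (smt (verit, best) Collect_mono)
  qed (use S0 bdd that in auto)
  have W_step: "W s + w s t \<le> W t" if st: "a \<le> s" "s \<le> t" "t \<le> b" "{s..t} \<subseteq> U" for s t
  proof -
    have "W s \<le> W t - w s t"
      unfolding W_def[of s]
    proof (rule cSup_least)
      fix x assume "x \<in> S s"
      then obtain N l u where f: "fam s N l u" and x: "x = (\<Sum>i<N. w (l i) (u i))"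
        unfolding S_def mem_Collect_eq by (elim exE conjE)
      \<comment> \<open>Superadditivity of \<open>W\<close>: the interval from \<open>s\<close> to
        \<open>t\<close> is appended to a family that ends by \<open>s\<close> and so cannot overlap
        it.\<close>
      have f': "fam t (Suc N) (l(N := s)) (u(N := t))"
        unfolding fam_def
      proof (intro conjI allI impI)
        fix i j assume "i < Suc N" "j < Suc N" "i \<noteq> j"
        then show "(u(N := t)) i \<le> (l(N := s)) j \<or> (u(N := t)) j \<le> (l(N := s)) i"
          using f unfolding fam_def by (auto simp: less_Suc_eq)
      qed (use f st in \<open>auto simp: fam_def less_Suc_eq intro: order_trans\<close>)
      have "x + w s t = (\<Sum>i<Suc N. w ((l(N := s)) i) ((u(N := t)) i))"
        unfolding x by simp
      then have "x + w s t \<in> S t" using f' unfolding S_def by blast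
      then have "x + w s t \<le> W t" unfolding W_def using bdd st by (intro cSup_upper) auto
      then show "x \<le> W t - w s t" by simp
    qed (use S0 in auto)
    then show ?thesis by simp
  qed
  define P where "P t \<longleftrightarrow> g t - g a \<le> (c + e) * (t - a) + W t" for t
  have cont_g: "continuous_on {a..b} g"
    unfolding continuous_on_def
  proof
    fix x assume x: "x \<in> {a..b}"
    have "continuous_on {a..b} z" using ac by (rule abs_continuous_on_interval_imp_continuous_on)
    then have "((\<lambda>y. C * norm (z y - z x)) \<longlongrightarrow> C * norm (z x - z x)) (at x within {a..b})"
      using x unfolding continuous_on_def by (intro tendsto_intros) auto
    moreover have "\<forall>\<^sub>F y in at x within {a..b}. norm (g y - g x) \<le> C * norm (z y - z x)"
      unfolding eventually_at_filter
    proof (intro always_eventually allI impI)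
      fix y assume "y \<in> {a..b}"
      then show "norm (g y - g x) \<le> C * norm (z y - z x)"
        using dom[of x y] dom[of y x] x by (cases "x \<le> y") (auto simp: abs_minus_commute norm_minus_commute)
    qed
    moreover have "C * norm (z x - z x) = 0" by simp
    ultimately have "((\<lambda>y. g y - g x) \<longlongrightarrow> 0) (at x within {a..b})"
      using Lim_null_comparison[of "\<lambda>y. g y - g x" "\<lambda>y. C * norm (z y - z x)"] by simp
    then show "(g \<longlongrightarrow> g x) (at x within {a..b})" by (simp add: LIM_zero_iff)
  qed
  define A where "A = {t \<in> {a..b}. \<forall>s\<in>{a..t}. P s}"
  have Pa: "P a"
    unfolding P_def using C S0[of a] bdd[OF ab] by (simp add: W_def cSup_upper)
  have aA: "a \<in> A" using Pa ab by (auto simp: A_def)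
  define \<sigma> where "\<sigma> = Sup A"
  have bA: "bdd_above A" by (auto simp: A_def intro!: bdd_aboveI[of _ b])
  have \<sigma>: "a \<le> \<sigma>" "\<sigma> \<le> b"
    unfolding \<sigma>_def using aA bA by (auto intro!: cSup_upper cSup_least simp: A_def)
  have below: "P s" if s: "a \<le> s" "s < \<sigma>" for s
  proof -
    have "A \<noteq> {}" using aA by blast
    then obtain t where "t \<in> A" "s < t" using s(2) less_cSupE[of s A] unfolding \<sigma>_def by blast
    then show ?thesis using s by (auto simp: A_def)
  qed
  have P\<sigma>: "P \<sigma>"
  proof (cases "\<sigma> = a")
    case False
    let ?h = "\<lambda>s. g s - g a - (c + e) * (s - a)"
    \<comment> \<open>No left continuity of \<open>W\<close> is at hand; monotonicity replaces
      \<open>W s\<close> by the constant \<open>W \<sigma>\<close>, after which continuity of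
      \<open>g\<close> closes the gap.\<close>
    have "?h \<sigma> \<le> W \<sigma>"
    proof (rule continuous_le_on_closure[where f = ?h and S = "{a..<\<sigma>}"])
      show "continuous_on (closure {a..<\<sigma>}) ?h"
        using \<sigma> False by (auto intro!: continuous_intros continuous_on_subset[OF cont_g])
      show "\<sigma> \<in> closure {a..<\<sigma>}" using \<sigma> False by simp
      fix s assume s: "s \<in> {a..<\<sigma>}"
      then have "?h s \<le> W s" using below[of s] by (simp add: P_def)
      also have "\<dots> \<le> W \<sigma>" using s \<sigma> by (intro W_mono) auto
      finally show "?h s \<le> W \<sigma>" .
    qed
    then show ?thesis by (simp add: P_def)
  qed (use Pa in simp)
  have "\<sigma> = b"
  proof (rule ccontr)
    assume "\<sigma> \<noteq> b"
    then have lt: "\<sigma> < b" using \<sigma> by simp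
    \<comment> \<open>Either \<open>\<sigma>\<close> lies in the open cover, and \<open>W\<close>
      absorbs a whole interval to its right, or \<open>\<sigma>\<close> avoids the exceptional set
      and its right slopes are good.\<close>
    have "\<exists>d>0. \<forall>v. \<sigma> < v \<and> v < \<sigma> + d \<and> v \<le> b \<longrightarrow> P v"
    proof (cases "\<sigma> \<in> U")
      case True
      then obtain r where r: "r > 0" "ball \<sigma> r \<subseteq> U" using U(1) open_contains_ball by blast
      have "P v" if v: "\<sigma> < v" "v < \<sigma> + r" "v \<le> b" for v
      proof -
        have "{\<sigma>..v} \<subseteq> U" using r v by (auto simp: subset_iff dist_real_def)
        then have "W \<sigma> + w \<sigma> v \<le> W v"
          using v \<sigma> by (intro W_step) auto
        moreover have "g v - g \<sigma> \<le> (c + e) * (v - \<sigma>) + w \<sigma> v"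
        proof -
          have "- \<bar>c\<bar> * (v - \<sigma>) \<le> (c + e) * (v - \<sigma>)" using v e by (intro mult_right_mono) auto
          with dom[of \<sigma> v] v \<sigma> show ?thesis by (simp add: w_def)
        qed
        ultimately show ?thesis using P\<sigma> by (simp add: P_def algebra_simps)
      qed
      with r show ?thesis by blast
    next
      case False
      then have "good \<sigma>" using X U \<sigma> lt by blast
      then obtain d where d: "d > 0" "\<And>v. \<sigma> < v \<Longrightarrow> v < \<sigma> + d \<Longrightarrow> v \<le> b \<Longrightarrow> g v - g \<sigma> \<le> (c + e) * (v - \<sigma>)"
        using e unfolding good_def by meson
      have "P v" if v: "\<sigma> < v" "v < \<sigma> + d" "v \<le> b" for v
      proof -
        have "W \<sigma> \<le> W v" using v by (intro W_mono) auto
        with d(2)[OF v] P\<sigma> show ?thesis by (simp add: P_def algebra_simps)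
      qed
      with d show ?thesis by blast
    qed
    then obtain d where d: "d > 0" "\<And>v. \<sigma> < v \<Longrightarrow> v < \<sigma> + d \<Longrightarrow> v \<le> b \<Longrightarrow> P v" by blast
    define v where "v = min b (\<sigma> + d / 2)"
    have v: "\<sigma> < v" "v < \<sigma> + d" "v \<le> b" using d(1) lt by (auto simp: v_def)
    have "P s" if "a \<le> s" "s \<le> v" for s
      using below[of s] P\<sigma> d(2)[of s] that v by (cases s \<sigma> rule: linorder_cases) auto
    then have "v \<in> A" using v \<sigma> by (auto simp: A_def)
    then have "v \<le> \<sigma>" unfolding \<sigma>_def using bA by (rule cSup_upper)
    with v show False by simp
  qed
  with P\<sigma> have "g b - g a \<le> (c + e) * (b - a) + W b" by (simp add: P_def)
  also have "\<dots> \<le> (c + e) * (b - a) + (C + \<bar>c\<bar>) * e" using W_le by simp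
  also have "\<dots> \<le> c * (b - a) + e * ((b - a) + C + \<bar>c\<bar> + 1)" using e by (simp add: algebra_simps)
  also have "\<dots> = c * (b - a) + e0" using den by (simp add: e_def)
  finally show "g b - g a \<le> c * (b - a) + e0" .
qed

section \<open>Almost everywhere differentiability of Lipschitz functions\<close>

text \<open>A ball of radius below \<open>\<rho> / 2\<close> that contains \<open>t\<close> stays
  within \<open>ball t \<rho>\<close>, so arbitrarily fine balls fit inside \<open>U\<close>, even
  when \<open>t\<close> is not their centre.\<close>

lemma Vitali_balls_in_open:
  fixes S U :: "real set"
  assumes "open U" "S \<subseteq> U"
    and fine: "\<And>t d. t \<in> S \<Longrightarrow> 0 < d \<Longrightarrow> \<exists>a r. 0 < r \<and> r < d \<and> t \<in> ball a r \<and> P a r"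
  obtains C where "countable C" "\<And>a r. (a, r) \<in> C \<Longrightarrow> 0 < r \<and> P a r \<and> ball a r \<subseteq> U"
    "disjoint_family_on (\<lambda>(a, r). ball a r) C" "negligible (S - (\<Union>(a, r)\<in>C. ball a r))"
proof -
  let ?K = "{(a, r). 0 < r \<and> P a r \<and> ball a r \<subseteq> U}"
  have "\<exists>i. i \<in> ?K \<and> t \<in> ball (fst i) (snd i) \<and> snd i < d" if t: "t \<in> S" and d: "0 < d" for t d
  proof -
    obtain \<rho> where \<rho>: "\<rho> > 0" "ball t \<rho> \<subseteq> U" using assms(1,2) t open_contains_ball by blast
    obtain a r where ar: "0 < r" "r < min d (\<rho> / 2)" "t \<in> ball a r" "P a r"
      using fine[OF t, of "min d (\<rho> / 2)"] d \<rho> by auto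
    have "ball a r \<subseteq> ball t \<rho>"
    proof
      fix y assume "y \<in> ball a r"
      then have "dist t y < r + r" using ar(3) dist_triangle[of t y a] by (simp add: dist_commute)
      with ar(2) show "y \<in> ball t \<rho>" by simp
    qed
    with \<rho> ar show ?thesis by (intro exI[of _ "(a, r)"]) auto
  qed
  then obtain C where C: "countable C" "C \<subseteq> ?K"
    "pairwise (\<lambda>i j. disjnt (ball (fst i) (snd i)) (ball (fst j) (snd j))) C"
    "negligible (S - (\<Union>i\<in>C. ball (fst i) (snd i)))"
    by (rule Vitali_covering_theorem_balls)
  show thesis
  proof (rule that[of C])
    show "0 < r \<and> P a r \<and> ball a r \<subseteq> U" if "(a, r) \<in> C" for a r
      using C(2) that by blast
    show "disjoint_family_on (\<lambda>(a, r). ball a r) C"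
      using C(3) by (auto simp: disjoint_family_on_def pairwise_def disjnt_def case_prod_unfold)
  qed (use C in \<open>auto simp: case_prod_unfold\<close>)
qed

text \<open>The factors on both sides let one comparison serve twice: the Stieltjes measure of
  \<open>g\<close> against \<open>p\<close> times length, and \<open>q\<close> times length against
  that measure.\<close>

lemma emeasure_disjoint_balls_le:
  fixes C :: "(real \<times> real) set"
  assumes "sets \<mu> = sets borel" "sets \<nu> = sets borel" "countable C"
    and "disjoint_family_on (\<lambda>(a, r). ball a r) C"
    and le: "\<And>a r. (a, r) \<in> C \<Longrightarrow> emeasure \<mu> (ball a r) * p \<le> emeasure \<nu> (ball a r) * q"
  shows "emeasure \<mu> (\<Union>(a, r)\<in>C. ball a r) * p \<le> emeasure \<nu> (\<Union>(a, r)\<in>C. ball a r) * q"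
proof -
  have "emeasure \<mu> (\<Union>(a, r)\<in>C. ball a r) * p = (\<integral>\<^sup>+i. emeasure \<mu> (case i of (a, r) \<Rightarrow> ball a r) \<partial>count_space C) * p"
    using assms by (subst emeasure_UN_countable) auto
  also have "\<dots> = (\<integral>\<^sup>+i. emeasure \<mu> (case i of (a, r) \<Rightarrow> ball a r) * p \<partial>count_space C)"
    by (rule nn_integral_multc[symmetric]) simp
  also have "\<dots> \<le> (\<integral>\<^sup>+i. emeasure \<nu> (case i of (a, r) \<Rightarrow> ball a r) * q \<partial>count_space C)"
    using le by (intro nn_integral_mono) (auto simp: case_prod_unfold)
  also have "\<dots> = (\<integral>\<^sup>+i. emeasure \<nu> (case i of (a, r) \<Rightarrow> ball a r) \<partial>count_space C) * q"
    by (rule nn_integral_multc) simp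
  also have "\<dots> = emeasure \<nu> (\<Union>(a, r)\<in>C. ball a r) * q"
    using assms by (subst emeasure_UN_countable) auto
  finally show ?thesis .
qed

text \<open>Continuity of \<open>g\<close> rules out atoms, so the endpoints of the closed interval
  carry no mass.\<close>

lemma emeasure_interval_measure_ball:
  fixes g :: "real \<Rightarrow> real"
  assumes "mono g" "continuous_on UNIV g" "0 < r"
  shows "emeasure (interval_measure g) (ball a r) = ennreal (g (a + r) - g (a - r))"
proof -
  have Icc: "emeasure (interval_measure g) {x..y} = ennreal (g y - g x)" if "x \<le> y" for x y
    using assms that by (intro emeasure_interval_measure_Icc) (auto simp: mono_def)
  have null: "{x} \<in> null_sets (interval_measure g)" for x
    using Icc[of x x] by (auto simp: null_sets_def)
  have "ball a r = {a - r..a + r} - ({a - r} \<union> {a + r})"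
    by (auto simp: dist_real_def)
  moreover have "emeasure (interval_measure g) ({a - r..a + r} - ({a - r} \<union> {a + r})) =
      emeasure (interval_measure g) {a - r..a + r}"
    using null by (intro emeasure_Diff_null_set null_sets.Un) auto
  ultimately show ?thesis using assms(3) by (simp add: Icc)
qed

text \<open>Vitali's theorem is used twice: disjoint balls with slope at most \<open>p\<close> inside a nearly optimal
  open cover \<open>U\<close>, then disjoint balls with slope at least \<open>q\<close> inside the former. This shrinks the
  outer measure by the factor \<open>p / q < 1\<close>.\<close>
lemma negligible_slope_oscillation:
  fixes g :: "real \<Rightarrow> real"
  assumes g: "mono g" "continuous_on UNIV g" and pq: "0 < p" "p < q" and bE: "bounded E"
    and low: "\<And>t d. t \<in> E \<Longrightarrow> 0 < d \<Longrightarrow>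
        \<exists>a r. 0 < r \<and> r < d \<and> t \<in> ball a r \<and> g (a + r) - g (a - r) \<le> p * (2 * r)"
    and up: "\<And>t d. t \<in> E \<Longrightarrow> 0 < d \<Longrightarrow>
        \<exists>a r. 0 < r \<and> r < d \<and> t \<in> ball a r \<and> q * (2 * r) \<le> g (a + r) - g (a - r)"
  shows "negligible E"
proof -
  let ?\<nu> = "interval_measure g"
  \<comment> \<open>\<open>m\<close> is the outer Lebesgue measure of \<open>E\<close>, whose
    measurability is not assumed; boundedness of \<open>E\<close> provides at least one open
    superset of finite measure.\<close>
  define X where "X = {x. \<exists>U. open U \<and> E \<subseteq> U \<and> U \<in> lmeasurable \<and> x = measure lebesgue U}"
  define m where "m = Inf X"
  have X0: "x \<ge> 0" if "x \<in> X" for x using that by (auto simp: X_def)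
  have ne: "X \<noteq> {}"
  proof -
    obtain R where "E \<subseteq> ball 0 R" using bE bounded_subset_ballD by blast
    then show ?thesis unfolding X_def by (auto intro!: exI[of _ "ball 0 R"])
  qed
  have bdd: "bdd_below X" unfolding bdd_below_def using X0 by blast
  have m0: "m \<ge> 0" unfolding m_def using ne X0 by (rule cInf_greatest)
  have shrink: "q * m \<le> p * x" if xX: "x \<in> X" for x
  proof -
    obtain U where U: "open U" "E \<subseteq> U" "U \<in> lmeasurable" and x: "x = measure lebesgue U"
      using xX by (auto simp: X_def)
    obtain C where C: "countable C"
      "\<And>a r. (a, r) \<in> C \<Longrightarrow> 0 < r \<and> g (a + r) - g (a - r) \<le> p * (2 * r) \<and> ball a r \<subseteq> U"
      "disjoint_family_on (\<lambda>(a, r). ball a r) C" "negligible (E - (\<Union>(a, r)\<in>C. ball a r))"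
      by (rule Vitali_balls_in_open[OF U(1,2) low]) auto
    define V where "V = (\<Union>(a, r)\<in>C. ball a r)"
    have V: "open V" "V \<subseteq> U" using C(2) by (auto simp: V_def)
    obtain D where D: "countable D"
      "\<And>a r. (a, r) \<in> D \<Longrightarrow> 0 < r \<and> q * (2 * r) \<le> g (a + r) - g (a - r) \<and> ball a r \<subseteq> V"
      "disjoint_family_on (\<lambda>(a, r). ball a r) D" "negligible (E \<inter> V - (\<Union>(a, r)\<in>D. ball a r))"
      by (rule Vitali_balls_in_open[of V "E \<inter> V", OF V(1) _ up]) auto
    define V' where "V' = (\<Union>(a, r)\<in>D. ball a r)"
    have V': "open V'" "V' \<subseteq> V" using D(2) by (auto simp: V'_def)
    have "emeasure ?\<nu> V * 1 \<le> emeasure lborel V * ennreal p"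
      unfolding V_def
    proof (rule emeasure_disjoint_balls_le)
      fix a r assume ar: "(a, r) \<in> C"
      have "emeasure lborel (ball a r) = ennreal (2 * r)" using C(2)[OF ar] by (simp add: ball_eq_greaterThanLessThan)
      then show "emeasure ?\<nu> (ball a r) * 1 \<le> emeasure lborel (ball a r) * ennreal p"
        using C(2)[OF ar] pq by (simp add: emeasure_interval_measure_ball g ennreal_mult''[symmetric] mult.commute ennreal_leI)
    qed (use C in auto)
    moreover have "emeasure lborel V' * ennreal q \<le> emeasure ?\<nu> V' * 1"
      unfolding V'_def
    proof (rule emeasure_disjoint_balls_le)
      fix a r assume ar: "(a, r) \<in> D"
      have "emeasure lborel (ball a r) = ennreal (2 * r)" using D(2)[OF ar] by (simp add: ball_eq_greaterThanLessThan)
      then show "emeasure lborel (ball a r) * ennreal q \<le> emeasure ?\<nu> (ball a r) * 1"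
        using D(2)[OF ar] pq by (simp add: emeasure_interval_measure_ball g ennreal_mult''[symmetric] mult.commute ennreal_leI)
    qed (use D in auto)
    moreover have "emeasure ?\<nu> V' \<le> emeasure ?\<nu> V" using V V' by (intro emeasure_mono) auto
    moreover have "emeasure lborel V \<le> emeasure lborel U" using U V by (intro emeasure_mono) auto
    ultimately have key: "emeasure lborel V' * ennreal q \<le> emeasure lborel U * ennreal p"
      by (metis mult.right_neutral mult_right_mono order_trans zero_le)
    have V'm: "V' \<in> lmeasurable"
      by (rule fmeasurableI2[OF U(3)]) (use V V' in auto)
    have leb: "emeasure lborel A = ennreal (measure lebesgue A)" if "open A" "A \<in> lmeasurable" for A :: "real set"
    proof -
      have "emeasure lborel A = emeasure lebesgue A" using that(1) by simp
      with that(2) show ?thesis by (simp add: emeasure_eq_measure2)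
    qed
    have "ennreal (measure lebesgue V' * q) \<le> ennreal (measure lebesgue U * p)"
      using key leb[OF U(1,3)] leb[OF V'(1) V'm] pq by (simp add: ennreal_mult'')
    then have key': "measure lebesgue V' * q \<le> x * p"
      using pq by (simp add: x)
    have neg: "negligible (E - V')"
    proof (rule negligible_subset)
      show "negligible ((E - V) \<union> (E \<inter> V - V'))"
        using C(4) D(4) by (simp add: V_def V'_def)
    qed auto
    \<comment> \<open>\<open>E \<union> V'\<close> differs from \<open>V'\<close> only by the
      negligible \<open>E - V'\<close>, hence is measurable; an open superset of it bounds
      \<open>m\<close>, as it also contains \<open>E\<close>.\<close>
    have sym: "(V' - (E \<union> V')) \<union> ((E \<union> V') - V') = E - V'" by auto
    have E: "E \<union> V' \<in> lmeasurable" "measure lebesgue (E \<union> V') = measure lebesgue V'"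
      using lmeasurable_negligible_symdiff[OF V'm, of "E \<union> V'"]
        measure_negligible_symdiff[OF V'm, of "E \<union> V'"] neg by (simp_all only: sym)
    have "m \<le> measure lebesgue V' + e" if e: "e > 0" for e
    proof -
      obtain T where T: "open T" "E \<union> V' \<subseteq> T" "(T - (E \<union> V')) \<in> lmeasurable"
        "emeasure lebesgue (T - (E \<union> V')) < ennreal e"
        using sets_lebesgue_outer_open[OF fmeasurableD[OF E(1)] e] .
      have Tm: "T = (T - (E \<union> V')) \<union> (E \<union> V')" using T(2) by auto
      have "T \<in> lmeasurable" by (subst Tm) (intro fmeasurable.Un T E)
      then have "measure lebesgue T \<in> X" using T by (auto simp: X_def)
      then have "m \<le> measure lebesgue T" unfolding m_def by (rule cInf_lower[OF _ bdd])
      also have "\<dots> \<le> measure lebesgue (T - (E \<union> V')) + measure lebesgue (E \<union> V')"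
        by (subst Tm) (intro measure_Un_le fmeasurableD T E)
      also have "measure lebesgue (T - (E \<union> V')) < e"
        using T(3,4) e by (simp add: emeasure_eq_measure2 ennreal_less_iff)
      finally show ?thesis using E(2) by simp
    qed
    then have "m \<le> measure lebesgue V'" by (rule field_le_epsilon)
    then have "q * m \<le> q * measure lebesgue V'" using pq by simp
    with key' show ?thesis by (simp add: mult.commute)
  qed
  \<comment> \<open>Since \<open>q / p > 1\<close>, this inequality leaves only
    \<open>m = 0\<close>.\<close>
  have "q / p * m \<le> m"
    unfolding m_def by (rule cInf_greatest[OF ne]) (use shrink pq in \<open>simp add: m_def field_simps\<close>)
  then have "m = 0" using pq m0 by (simp add: field_simps mult_le_cancel_left)
  show ?thesis
    unfolding negligible_outer
  proof (intro allI impI)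
    fix e :: real assume "e > 0"
    then obtain x where "x \<in> X" "x < e"
      using \<open>m = 0\<close> cInf_lessD[OF ne, of e] by (auto simp: m_def)
    then show "\<exists>T. E \<subseteq> T \<and> T \<in> lmeasurable \<and> measure lebesgue T < e" by (auto simp: X_def)
  qed
qed

text \<open>The candidate is the supremum of the slopes that are eventually lower bounds. A rational
  just above it fails to be one, so absence of oscillation turns a second, larger rational into an
  eventual upper bound.\<close>

lemma slope_limit_exists:
  fixes g :: "real \<Rightarrow> real"
  assumes L: "\<And>x y. x \<le> y \<Longrightarrow> 0 \<le> g y - g x \<and> g y - g x \<le> L * (y - x)"
    and noosc: "\<And>p q. p \<in> \<rat> \<Longrightarrow> q \<in> \<rat> \<Longrightarrow> 0 < p \<Longrightarrow> p < q \<Longrightarrow> \<exists>d>0.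
        (\<forall>a r. 0 < r \<and> r < d \<and> t \<in> ball a r \<longrightarrow> p * (2 * r) < g (a + r) - g (a - r)) \<or>
        (\<forall>a r. 0 < r \<and> r < d \<and> t \<in> ball a r \<longrightarrow> g (a + r) - g (a - r) < q * (2 * r))"
  obtains l where "\<And>e. e > 0 \<Longrightarrow> \<exists>d>0. \<forall>a r. 0 < r \<and> r < d \<and> t \<in> ball a r \<longrightarrow>
      \<bar>g (a + r) - g (a - r) - l * (2 * r)\<bar> \<le> e * (2 * r)"
proof -
  define low where "low c \<longleftrightarrow> (\<exists>d>0. \<forall>a r. 0 < r \<and> r < d \<and> t \<in> ball a r \<longrightarrow>
      c * (2 * r) \<le> g (a + r) - g (a - r))" for c
  have low0: "low 0"
    unfolding low_def using L by (intro exI[of _ "1::real"]) simp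
  have low_le: "c \<le> L" if c: "low c" for c
  proof -
    obtain d where d: "d > 0" "\<forall>a r. 0 < r \<and> r < d \<and> t \<in> ball a r \<longrightarrow> c * (2 * r) \<le> g (a + r) - g (a - r)"
      using c unfolding low_def by blast
    then have "c * (2 * (d/2)) \<le> g (t + d/2) - g (t - d/2)"
      using d(2)[THEN spec, of t, THEN spec, of "d/2"] by simp
    also have "\<dots> \<le> L * (2 * (d/2))" using L[of "t - d/2" "t + d/2"] d(1) by (simp add: field_simps)
    finally show ?thesis using d(1) by simp
  qed
  define l where "l = Sup (Collect low)"
  have bdd: "bdd_above (Collect low)" unfolding bdd_above_def using low_le by blast
  have l0: "0 \<le> l" unfolding l_def using low0 bdd by (simp add: cSup_upper)
  show thesis
  proof (rule that[of l])
    fix e :: real assume e: "e > 0"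
    obtain c where c: "low c" "l - e < c"
      using less_cSupD[of "Collect low" "l - e"] low0 e by (auto simp: l_def)
    obtain d1 where d1: "d1 > 0" "\<And>a r. 0 < r \<Longrightarrow> r < d1 \<Longrightarrow> t \<in> ball a r \<Longrightarrow> c * (2 * r) \<le> g (a + r) - g (a - r)"
      using c(1) unfolding low_def by blast
    \<comment> \<open>\<open>low 0\<close> gave \<open>l \<ge> 0\<close>, so both rationals are
      positive, as \<open>noosc\<close> demands.\<close>
    obtain p where p: "p \<in> \<rat>" "l < p" "p < l + e" using Rats_dense_in_real[of l "l + e"] e by auto
    obtain q where q: "q \<in> \<rat>" "p < q" "q < l + e" using Rats_dense_in_real[OF p(3)] by auto
    have nlow: "\<not> low p"
    proof
      assume "low p"
      then have "p \<le> l" unfolding l_def using bdd \<open>low p\<close> by (simp add: cSup_upper)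
      with p show False by simp
    qed
    obtain d2 where d2: "d2 > 0" "(\<forall>a r. 0 < r \<and> r < d2 \<and> t \<in> ball a r \<longrightarrow> p * (2 * r) < g (a + r) - g (a - r)) \<or>
        (\<forall>a r. 0 < r \<and> r < d2 \<and> t \<in> ball a r \<longrightarrow> g (a + r) - g (a - r) < q * (2 * r))"
      using noosc[OF p(1) q(1)] p q l0 by auto
    with nlow have d2': "\<And>a r. 0 < r \<Longrightarrow> r < d2 \<Longrightarrow> t \<in> ball a r \<Longrightarrow> g (a + r) - g (a - r) < q * (2 * r)"
      unfolding low_def by (meson less_imp_le)
    show "\<exists>d>0. \<forall>a r. 0 < r \<and> r < d \<and> t \<in> ball a r \<longrightarrow>
      \<bar>g (a + r) - g (a - r) - l * (2 * r)\<bar> \<le> e * (2 * r)"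
    proof (intro exI[of _ "min d1 d2"] conjI allI impI)
      fix a r assume ar: "0 < r \<and> r < min d1 d2 \<and> t \<in> ball a r"
      have "(l - e) * (2 * r) \<le> c * (2 * r)" "q * (2 * r) \<le> (l + e) * (2 * r)"
        using c q ar by (auto intro!: mult_right_mono)
      with d1(2)[of r a] d2'[of r a] ar
      show "\<bar>g (a + r) - g (a - r) - l * (2 * r)\<bar> \<le> e * (2 * r)"
        by (simp add: algebra_simps abs_le_iff)
    qed (use d1 d2 in auto)
  qed
qed

text \<open>Slopes are known only over intervals with \<open>t\<close> strictly inside. Letting one
  endpoint tend to \<open>t\<close>, with \<open>g\<close> continuous, turns them into one-sided
  difference quotients at \<open>t\<close>.\<close>

lemma has_real_derivative_if_slope_limit:
  fixes g :: "real \<Rightarrow> real"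
  assumes cont: "continuous_on UNIV g"
    and sl: "\<And>e. e > 0 \<Longrightarrow> \<exists>d>0. \<forall>a r. 0 < r \<and> r < d \<and> t \<in> ball a r \<longrightarrow>
      \<bar>g (a + r) - g (a - r) - l * (2 * r)\<bar> \<le> e * (2 * r)"
  shows "(g has_real_derivative l) (at t)"
proof -
  have "\<exists>d>0. \<forall>y. norm (y - t) < d \<longrightarrow> norm (g y - g t - l * (y - t)) \<le> e * norm (y - t)" if e: "e > 0" for e
  proof -
    obtain d where d: "d > 0" "\<And>a r. 0 < r \<Longrightarrow> r < d \<Longrightarrow> t \<in> ball a r \<Longrightarrow>
      \<bar>g (a + r) - g (a - r) - l * (2 * r)\<bar> \<le> e * (2 * r)" using sl[OF e] by blast
    have uv: "\<bar>g v - g u - l * (v - u)\<bar> \<le> e * (v - u)" if "u < t" "t < v" "v - u < d" for u v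
    proof -
      have eq: "(u + v) / 2 + (v - u) / 2 = v" "(u + v) / 2 - (v - u) / 2 = u" "2 * ((v - u) / 2) = v - u"
        by (auto simp: field_simps)
      have "t \<in> ball ((u + v) / 2) ((v - u) / 2)"
        using that by (auto simp: dist_real_def abs_less_iff field_simps)
      then show ?thesis using d(2)[of "(v - u) / 2" "(u + v) / 2"] that unfolding eq by simp
    qed
    have right: "\<bar>g v - g t - l * (v - t)\<bar> - e * (v - t) \<le> 0" if v: "t < v" "v < t + d" for v
    proof -
      let ?h = "\<lambda>u. \<bar>g v - g u - l * (v - u)\<bar> - e * (v - u)"
      have "?h t \<le> 0"
      proof (rule continuous_le_on_closure[where f = ?h and S = "{v - d<..<t}"])
      show "continuous_on (closure {v - d<..<t}) ?h"
        by (intro continuous_intros continuous_on_subset[OF cont]) auto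
      show "t \<in> closure {v - d<..<t}" using v by simp
      show "?h u \<le> 0" if "u \<in> {v - d<..<t}" for u using uv[of u v] that v by auto
      qed
      then show ?thesis .
    qed
    have left: "\<bar>g t - g u - l * (t - u)\<bar> - e * (t - u) \<le> 0" if u: "u < t" "t < u + d" for u
    proof -
      let ?h = "\<lambda>v. \<bar>g v - g u - l * (v - u)\<bar> - e * (v - u)"
      have "?h t \<le> 0"
      proof (rule continuous_le_on_closure[where f = ?h and S = "{t<..<u + d}"])
      show "continuous_on (closure {t<..<u + d}) ?h"
        by (intro continuous_intros continuous_on_subset[OF cont]) auto
      show "t \<in> closure {t<..<u + d}" using u by simp
      show "?h v \<le> 0" if "v \<in> {t<..<u + d}" for v using uv[of u v] that u by auto
      qed
      then show ?thesis .
    qed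
    have "norm (g y - g t - l * (y - t)) \<le> e * norm (y - t)" if y: "norm (y - t) < d" for y
    proof (cases y t rule: linorder_cases)
      case less
      have "\<bar>g y - g t - l * (y - t)\<bar> = \<bar>g t - g y - l * (t - y)\<bar>"
        by (simp add: algebra_simps abs_minus_commute)
      with left[of y] less y show ?thesis by simp
    qed (use right[of y] y in auto)
    with d(1) show ?thesis by blast
  qed
  then show ?thesis
    unfolding has_field_derivative_def has_derivative_at_alt by (auto intro: bounded_linear_mult_right)
qed

lemma lipschitz_real_differentiable_AE:
  fixes f :: "real \<Rightarrow> real"
  assumes lip: "\<And>x y. x \<le> y \<Longrightarrow> \<bar>f y - f x\<bar> \<le> L * (y - x)"
  shows "AE t in lborel. f differentiable (at t)"
proof -
  \<comment> \<open>Adding \<open>L * t\<close> makes the function nondecreasing, so that it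
    generates a measure, without affecting differentiability.\<close>
  define g where "g t = f t + L * t" for t
  have g: "0 \<le> g y - g x" "g y - g x \<le> 2 * L * (y - x)" if "x \<le> y" for x y
    using lip[OF that] by (auto simp: g_def algebra_simps abs_le_iff)
  have mono: "mono g" using g(1) by (force simp: mono_def)
  have cont: "continuous_on UNIV g"
  proof (rule lipschitz_on_continuous_on)
    have "L \<ge> 0" using lip[of 0 1] by simp
    moreover have "dist (g x) (g y) \<le> 2 * L * dist x y" for x y
      using g[of x y] g[of y x] by (cases "x \<le> y") (auto simp: dist_real_def)
    ultimately show "lipschitz_on (2 * L) UNIV g" by (auto intro: lipschitz_onI)
  qed
  \<comment> \<open>Failure of the slope limit means oscillation across two positive rationals; with
    the bounds \<open>k\<close> this gives countably many bounded exceptional sets.\<close>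
  define E where "E p q k = {t. \<bar>t\<bar> < real k \<and>
     (\<forall>d>0. \<exists>a r. 0 < r \<and> r < d \<and> t \<in> ball a r \<and> g (a + r) - g (a - r) \<le> p * (2 * r)) \<and>
     (\<forall>d>0. \<exists>a r. 0 < r \<and> r < d \<and> t \<in> ball a r \<and> q * (2 * r) \<le> g (a + r) - g (a - r))}"
    for p q :: real and k
  have "negligible (E p q k)" if "0 < p" "p < q" for p q k
  proof (rule negligible_slope_oscillation[OF mono cont that])
    show "bounded (E p q k)" by (rule bounded_subset[of "ball 0 (real k)"]) (auto simp: E_def dist_real_def)
  qed (auto simp: E_def)
  moreover define I where "I = {(p, q). p \<in> \<rat> \<and> q \<in> \<rat> \<and> 0 < p \<and> p < (q::real)} \<times> (UNIV :: nat set)"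
  moreover have "countable I"
    unfolding I_def by (rule countable_SIGMA[OF countable_subset[of _ "\<rat> \<times> \<rat>"]]) (auto simp: countable_rat)
  ultimately have neg: "negligible (\<Union>i\<in>I. case i of ((p, q), k) \<Rightarrow> E p q k)"
    by (intro negligible_countable_Union countable_image) (auto simp: I_def)
  have diff: "f differentiable (at t)" if t: "t \<notin> (\<Union>i\<in>I. case i of ((p, q), k) \<Rightarrow> E p q k)" for t
  proof -
    obtain k :: nat where k: "\<bar>t\<bar> < real k" using reals_Archimedean2 by blast
    obtain l where "\<And>e. e > 0 \<Longrightarrow> \<exists>d>0. \<forall>a r. 0 < r \<and> r < d \<and> t \<in> ball a r \<longrightarrow>
      \<bar>g (a + r) - g (a - r) - l * (2 * r)\<bar> \<le> e * (2 * r)"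
    proof (rule slope_limit_exists)
      show "0 \<le> g y - g x \<and> g y - g x \<le> 2 * L * (y - x)" if "x \<le> y" for x y using g that by blast
      fix p q :: real assume pq: "p \<in> \<rat>" "q \<in> \<rat>" "0 < p" "p < q"
      then have "((p, q), k) \<in> I" by (auto simp: I_def)
      with t have "t \<notin> E p q k" by blast
      then show "\<exists>d>0.
        (\<forall>a r. 0 < r \<and> r < d \<and> t \<in> ball a r \<longrightarrow> p * (2 * r) < g (a + r) - g (a - r)) \<or>
        (\<forall>a r. 0 < r \<and> r < d \<and> t \<in> ball a r \<longrightarrow> g (a + r) - g (a - r) < q * (2 * r))"
        unfolding E_def mem_Collect_eq de_Morgan_conj not_all not_imp not_ex not_le using k by meson
    qed blast
    then have "(g has_real_derivative l) (at t)" by (rule has_real_derivative_if_slope_limit[OF cont])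
    then have "((\<lambda>t. g t - L * t) has_real_derivative l - L) (at t)"
      by (auto intro!: derivative_eq_intros)
    then show ?thesis by (auto simp: g_def real_differentiable_def)
  qed
  have "AE t in lebesgue. f differentiable (at t)"
    using neg diff by (auto simp: negligible_iff_null_sets intro!: AE_I'[where N = "\<Union>i\<in>I. case i of ((p, q), k) \<Rightarrow> E p q k"])
  then show ?thesis by (simp add: AE_completion_iff)
qed

lemma lipschitz_vec_differentiable_AE:
  fixes z :: "real \<Rightarrow> real^'n"
  assumes lip: "\<And>x y. x \<le> y \<Longrightarrow> norm (z y - z x) \<le> L * (y - x)"
  shows "AE t in lborel. z differentiable (at t)"
proof -
  have "AE t in lborel. \<forall>i\<in>Basis. (\<lambda>t. z t \<bullet> i) differentiable (at t)"
  proof (rule AE_finite_allI)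
    fix i :: "real^'n" assume i: "i \<in> Basis"
    show "AE t in lborel. (\<lambda>t. z t \<bullet> i) differentiable (at t)"
    proof (rule lipschitz_real_differentiable_AE)
      fix x y :: real assume "x \<le> y"
      then show "\<bar>z y \<bullet> i - z x \<bullet> i\<bar> \<le> L * (y - x)"
        using Basis_le_norm[OF i, of "z y - z x"] lip[of x y] by (simp add: inner_diff_left)
    qed
  qed simp
  then show ?thesis by eventually_elim (subst differentiable_componentwise_within, simp)
qed

section \<open>Cones, projections and metrics\<close>

lemma proj_setD:
  assumes "p \<in> proj_set Z z"
  shows "p \<in> Z" "dist z p = infdist z Z" "norm (z - p) = infdist z Z"
proof -
  show p: "p \<in> Z" using assms by (simp add: proj_set_def)
  show d: "dist z p = infdist z Z" using assms by (auto simp: proj_set_def infdist_def)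
  then show "norm (z - p) = infdist z Z" by (simp add: dist_norm)
qed

lemma proj_set_self: "x \<in> Z \<Longrightarrow> x \<in> proj_set Z x"
  using infdist_zero[of x Z] infdist_notempty[of Z x] by (auto simp: proj_set_def)

lemma inflated_if_infdist_less:
  assumes "p \<in> proj_set Z z" "infdist z Z < 1 / (2 * \<alpha>)"
  shows "z \<in> inflated Z \<alpha>"
  unfolding inflated_def mem_Collect_eq using proj_setD[OF assms(1)] assms(2)
  by (intro exI[of _ p] exI[of _ "z - p"]) simp

text \<open>Because \<open>p\<close> is nearest, \<open>norm (z - p) \<le> norm (z - xs k)\<close>.
  Expanding the square leaves \<open>2 * ((z - p) \<bullet> (xs k - p))\<close> at most the squared
  length of \<open>xs k - p\<close>, and this quadratic term vanishes in the limit even after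
  division by \<open>\<delta> k\<close>.\<close>

lemma proximal_normal_in_normal_cone:
  assumes "p \<in> proj_set Z z"
  shows "z - p \<in> normal_cone Z p"
  unfolding normal_cone_def
proof (intro CollectI ballI)
  fix v assume "v \<in> tangent_cone Z p"
  then obtain xs \<delta> where xs: "\<And>k. xs k \<in> Z" "xs \<longlonglongrightarrow> p" "\<And>k. \<delta> k > 0" "\<delta> \<longlonglongrightarrow> 0"
    "(\<lambda>k. (1 / \<delta> k) *\<^sub>R (xs k - p)) \<longlonglongrightarrow> v"
    unfolding tangent_cone_def by blast
  have le: "(z - p) \<bullet> ((1 / \<delta> k) *\<^sub>R (xs k - p)) \<le> (1/2) * norm ((1 / \<delta> k) *\<^sub>R (xs k - p)) * norm (xs k - p)" for k
  proof -
    have "norm (z - p) \<le> norm (z - xs k)"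
      using proj_setD(3)[OF assms] infdist_le[OF xs(1)[of k], of z] by (simp add: dist_norm)
    then have "(norm (z - p))\<^sup>2 \<le> (norm ((z - p) - (xs k - p)))\<^sup>2" by (intro power_mono) auto
    then have "2 * ((z - p) \<bullet> (xs k - p)) \<le> (norm (xs k - p))\<^sup>2"
      unfolding power2_norm_eq_inner by (simp add: inner_diff_left inner_diff_right inner_commute)
    then have "(1 / \<delta> k) * (2 * ((z - p) \<bullet> (xs k - p))) \<le> (1 / \<delta> k) * (norm (xs k - p))\<^sup>2"
      using xs(3)[of k] by (intro mult_left_mono) auto
    then show ?thesis using xs(3)[of k] by (simp add: power2_eq_square divide_simps)
  qed
  have "(\<lambda>k. (1/2) * norm ((1 / \<delta> k) *\<^sub>R (xs k - p)) * norm (xs k - p)) \<longlonglongrightarrow> (1/2) * norm v * norm (p - p)"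
    by (intro tendsto_intros xs)
  moreover have "(\<lambda>k. (z - p) \<bullet> ((1 / \<delta> k) *\<^sub>R (xs k - p))) \<longlonglongrightarrow> (z - p) \<bullet> v"
    by (intro tendsto_intros xs)
  ultimately have "(z - p) \<bullet> v \<le> (1/2) * norm v * norm (p - p)"
    using le by (intro LIMSEQ_le) auto
  then show "(z - p) \<bullet> v \<le> 0" by simp
qed

text \<open>The sequential form of inner semicontinuity is turned into a neighbourhood statement,
  since the projections to which it is applied vary with both time and index.\<close>

lemma clarke_regular_nearby_tangents:
  assumes "clarke_regular Z" "x \<in> Z" "w \<in> tangent_cone Z x" "e > 0"
  obtains d where "d > 0" "\<And>p. p \<in> Z \<Longrightarrow> dist p x < d \<Longrightarrow> \<exists>w'\<in>tangent_cone Z p. dist w' w < e"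
proof -
  have "\<exists>d>0. \<forall>p\<in>Z. dist p x < d \<longrightarrow> (\<exists>w'\<in>tangent_cone Z p. dist w' w < e)"
  proof (rule ccontr)
    assume *: "\<not> ?thesis"
    have "\<exists>p. p \<in> Z \<and> dist p x < 1 / real (Suc k) \<and> (\<forall>w'\<in>tangent_cone Z p. \<not> dist w' w < e)" for k
    proof -
      have "1 / real (Suc k) > 0" by simp
      with * show ?thesis by blast
    qed
    then obtain ps where ps: "\<And>k. ps k \<in> Z" "\<And>k. dist (ps k) x < 1 / real (Suc k)"
      "\<And>k w'. w' \<in> tangent_cone Z (ps k) \<Longrightarrow> \<not> dist w' w < e" by metis
    have "(\<lambda>k. 1 / real (Suc k)) \<longlonglongrightarrow> 0" using LIMSEQ_inverse_real_of_nat by (simp add: inverse_eq_divide)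
    then have "(\<lambda>k. dist (ps k) x) \<longlonglongrightarrow> 0"
      by (rule Lim_null_comparison[rotated]) (use ps(2) in \<open>auto intro!: always_eventually less_imp_le\<close>)
    then have "ps \<longlonglongrightarrow> x" by (simp add: tendsto_dist_iff[symmetric])
    then obtain vs where vs: "\<And>k. vs k \<in> tangent_cone Z (ps k)" "vs \<longlonglongrightarrow> w"
      using assms(1-3) ps(1) unfolding clarke_regular_def by blast
    from vs(2) assms(4) obtain k where "dist (vs k) w < e" unfolding lim_sequentially by blast
    with ps(3) vs(1) show False by blast
  qed
  with that show thesis by blast
qed

text \<open>At an interior time the path can be approached from both sides; the sign
  \<open>\<sigma>\<close> treats the forward and the backward sequence together.\<close>

lemma tangent_cone_vector_derivative:
  fixes z :: "real \<Rightarrow> real^'n"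
  assumes "a < t" "t < b" and inZ: "\<And>s. s \<in> {a..b} \<Longrightarrow> z s \<in> Z"
    and der: "(z has_vector_derivative v) (at t)"
  shows "v \<in> tangent_cone Z (z t)" "- v \<in> tangent_cone Z (z t)"
proof -
  have slope: "\<sigma> *\<^sub>R v \<in> tangent_cone Z (z t)" if \<sigma>: "\<bar>\<sigma>\<bar> = 1" for \<sigma> :: real
  proof -
    define \<eta> where "\<eta> = min (t - a) (b - t)"
    have \<eta>: "\<eta> > 0" "\<eta> \<le> t - a" "\<eta> \<le> b - t" using assms by (auto simp: \<eta>_def)
    define \<delta> where "\<delta> k = \<eta> / real (Suc k)" for k
    have \<delta>0: "\<delta> k > 0" "\<delta> k \<le> \<eta>" for k using \<eta> by (auto simp: \<delta>_def field_simps)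
    have \<delta>lim: "\<delta> \<longlonglongrightarrow> 0"
      using tendsto_mult_left[OF LIMSEQ_inverse_real_of_nat, of \<eta>] by (simp add: \<delta>_def[abs_def] divide_inverse)
    have D: "((\<lambda>h. (1 / h) *\<^sub>R (z (t + h) - z t)) \<longlongrightarrow> v) (at 0)"
    proof (rule Lim_null[THEN iffD2], rule tendsto_norm_zero_cancel)
      have "(\<lambda>h. norm (z (t + h) - z t - h *\<^sub>R v) / norm h) \<midarrow>0\<rightarrow> 0"
        using der unfolding has_vector_derivative_def has_derivative_at by blast
      moreover have "\<forall>\<^sub>F h in at 0. norm (z (t + h) - z t - h *\<^sub>R v) / norm h = norm ((1 / h) *\<^sub>R (z (t + h) - z t) - v)"
        unfolding eventually_at_filter
      proof (intro always_eventually allI impI)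
        fix h :: real assume "h \<noteq> 0"
        then have "(1 / h) *\<^sub>R (z (t + h) - z t) - v = (1 / h) *\<^sub>R (z (t + h) - z t - h *\<^sub>R v)"
          by (simp add: scaleR_diff_right)
        then show "norm (z (t + h) - z t - h *\<^sub>R v) / norm h = norm ((1 / h) *\<^sub>R (z (t + h) - z t) - v)"
          by (simp add: divide_inverse mult.commute)
      qed
      ultimately show "((\<lambda>h. norm ((1 / h) *\<^sub>R (z (t + h) - z t) - v)) \<longlongrightarrow> 0) (at 0)"
        by (rule Lim_transform_eventually)
    qed
    have fl: "filterlim (\<lambda>k. \<sigma> * \<delta> k) (at 0) sequentially"
      unfolding filterlim_at
    proof
      show "\<forall>\<^sub>F k in sequentially. \<sigma> * \<delta> k \<in> UNIV \<and> \<sigma> * \<delta> k \<noteq> 0"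
        using \<delta>0(1) \<sigma> by (intro always_eventually) (auto simp: less_imp_neq[symmetric])
      show "(\<lambda>k. \<sigma> * \<delta> k) \<longlonglongrightarrow> 0" using tendsto_mult_left[OF \<delta>lim, of \<sigma>] by simp
    qed
    have 1: "(\<lambda>k. (1 / (\<sigma> * \<delta> k)) *\<^sub>R (z (t + \<sigma> * \<delta> k) - z t)) \<longlonglongrightarrow> v"
      using filterlim_compose[OF D fl] .
    have "(\<lambda>k. \<sigma> *\<^sub>R (1 / (\<sigma> * \<delta> k)) *\<^sub>R (z (t + \<sigma> * \<delta> k) - z t)) \<longlonglongrightarrow> \<sigma> *\<^sub>R v"
      by (intro tendsto_intros 1)
    moreover have "\<sigma> *\<^sub>R (1 / (\<sigma> * \<delta> k)) *\<^sub>R (z (t + \<sigma> * \<delta> k) - z t) = (1 / \<delta> k) *\<^sub>R (z (t + \<sigma> * \<delta> k) - z t)" for k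
      using \<sigma> by auto
    ultimately have 2: "(\<lambda>k. (1 / \<delta> k) *\<^sub>R (z (t + \<sigma> * \<delta> k) - z t)) \<longlonglongrightarrow> \<sigma> *\<^sub>R v" by (simp only:)
    have "isCont z t" using der by (rule has_vector_derivative_continuous)
    moreover have "(\<lambda>k. t + \<sigma> * \<delta> k) \<longlonglongrightarrow> t" using tendsto_add[OF tendsto_const tendsto_mult_left[OF \<delta>lim, of \<sigma>], of t] by simp
    ultimately have 3: "(\<lambda>k. z (t + \<sigma> * \<delta> k)) \<longlonglongrightarrow> z t" by (rule isCont_tendsto_compose)
    have 4: "z (t + \<sigma> * \<delta> k) \<in> Z" for k
    proof -
      have "\<bar>\<sigma> * \<delta> k\<bar> \<le> \<eta>" using \<delta>0[of k] \<sigma> by (simp add: abs_mult)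
      then show ?thesis using \<eta> by (intro inZ) (auto simp: abs_le_iff)
    qed
    show ?thesis unfolding tangent_cone_def mem_Collect_eq
      by (intro exI[of _ "\<lambda>k. z (t + \<sigma> * \<delta> k)"] exI[of _ \<delta>] conjI allI 2 3 4 \<delta>0(1) \<delta>lim)
  qed
  show "v \<in> tangent_cone Z (z t)" "- v \<in> tangent_cone Z (z t)" using slope[of 1] slope[of "-1"] by auto
qed

section \<open>Symmetric matrices and the metric projection\<close>

lemma inner_matrix_vector_symmetric:
  fixes A :: "real^'n^'n"
  assumes "transpose A = A"
  shows "u \<bullet> (A *v w) = (A *v u) \<bullet> w"
  using dot_lmul_matrix[of u A w] assms by (metis transpose_matrix_vector)

lemma sym_pos_def_inverse:
  fixes A :: "real^'n^'n"
  assumes "sym_pos_def A"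
  shows "A *v (matrix_inv A *v u) = u" "transpose (matrix_inv A) = matrix_inv A"
proof -
  have "inj ((*v) A)"
  proof (rule linear_injective_0[THEN iffD2, rule_format])
    fix u assume "A *v u = 0"
    then show "u = 0" using assms unfolding sym_pos_def_def by (metis inner_zero_right less_irrefl)
  qed (rule matrix_vector_mul_linear)
  then have inv: "invertible A" by (simp add: invertible_left_inverse matrix_left_invertible_injective)
  have inv_right: "A ** matrix_inv A = mat 1"
    using inv unfolding invertible_def matrix_inv_def by (rule someI2_ex) blast
  show "A *v (matrix_inv A *v u) = u"
    using inv_right by (simp add: matrix_vector_mul_assoc)
  have tr: "transpose A = A" using assms by (simp add: sym_pos_def_def)
  \<comment> \<open>Transposition makes the transposed inverse a left inverse, which must coincide
    with the right inverse.\<close>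
  have "transpose (matrix_inv A) ** A = mat 1"
    using arg_cong[OF inv_right, of transpose] tr by (simp add: matrix_transpose_mul)
  then show "transpose (matrix_inv A) = matrix_inv A"
    by (metis inv_right matrix_mul_assoc matrix_mul_lid matrix_mul_rid)
qed

text \<open>The Loewner order bounds only the quadratic form. Testing nonnegativity of the form at
  \<open>w - (1 / \<nu>) *\<^sub>R (A *v w)\<close> gives
  \<open>(norm (A *v w))\<^sup>2 \<le> \<nu> * (w \<bullet> (A *v w))\<close>, and Cauchy-Schwarz
  finishes.\<close>

lemma norm_matrix_vector_le_of_loewner_le:
  fixes A :: "real^'n^'n"
  assumes sym: "transpose A = A" and psd: "\<And>u. 0 \<le> u \<bullet> (A *v u)" and le: "loewner_le A (\<nu> *\<^sub>R mat 1)" and \<nu>: "\<nu> > 0"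
  shows "norm (A *v w) \<le> \<nu> * norm w"
proof -
  let ?y = "A *v w"
  let ?u = "w - (1 / \<nu>) *\<^sub>R ?y"
  have up: "u \<bullet> (A *v u) \<le> \<nu> * (u \<bullet> u)" for u
    using le by (simp add: loewner_le_def scaleR_matrix_vector_assoc[symmetric])
  have "0 \<le> ?u \<bullet> (A *v ?u)" by (rule psd)
  also have "\<dots> = w \<bullet> ?y - (2 / \<nu>) * (?y \<bullet> ?y) + (1 / \<nu>)\<^sup>2 * (?y \<bullet> (A *v ?y))"
    using inner_matrix_vector_symmetric[OF sym, of w ?y]
    by (simp add: matrix_vector_mult_diff_distrib matrix_vector_mult_scaleR inner_diff_left inner_diff_right
        power2_eq_square algebra_simps)
  also have "\<dots> \<le> w \<bullet> ?y - (2 / \<nu>) * (?y \<bullet> ?y) + (1 / \<nu>)\<^sup>2 * (\<nu> * (?y \<bullet> ?y))"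
    using up[of ?y] by (intro add_left_mono mult_left_mono) auto
  also have "\<dots> = w \<bullet> ?y - (?y \<bullet> ?y) / \<nu>"
    using \<nu> by (simp add: power2_eq_square field_simps)
  finally have "(norm ?y)\<^sup>2 \<le> \<nu> * (w \<bullet> ?y)" using \<nu> by (simp add: power2_norm_eq_inner field_simps)
  also have "\<dots> \<le> \<nu> * (norm w * norm ?y)" using \<nu> norm_cauchy_schwarz by (intro mult_left_mono) auto
  finally have "norm ?y * norm ?y \<le> (\<nu> * norm w) * norm ?y" by (simp add: power2_eq_square)
  then show ?thesis using \<nu> by (cases "norm ?y = 0") (auto simp: mult_le_cancel_right)
qed

text \<open>The residual \<open>y - v\<close> is orthogonal to \<open>v\<close> because both \<open>v\<close> and \<open>- v\<close> are tangent.\<close>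
lemma proj_op_characterization:
  assumes spd: "sym_pos_def (G x)" and v: "v \<in> tangent_cone Z x" "- v \<in> tangent_cone Z x"
    and normal: "\<And>w. w \<in> tangent_cone Z x \<Longrightarrow> (y - v) \<bullet> (G x *v w) \<le> 0"
  shows "v \<in> proj_op Z G y x"
  unfolding proj_op_def
proof (intro CollectI conjI ballI v)
  fix w assume w: "w \<in> tangent_cone Z x"
  have sym: "transpose (G x) = G x" using spd by (simp add: sym_pos_def_def)
  have orth: "(y - v) \<bullet> (G x *v v) = 0"
    using normal[OF v(1)] normal[OF v(2)]
    by (simp add: vec.neg)
  have pos: "0 \<le> (w - v) \<bullet> (G x *v (w - v))"
    using spd unfolding sym_pos_def_def by (metis inner_zero_left less_imp_le order_refl)
  \<comment> \<open>Expansion of the squared metric norm about \<open>v\<close>; by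
    \<open>normal\<close> and \<open>orth\<close> the cross term contributes a nonnegative
    amount.\<close>
  have "(w - y) \<bullet> (G x *v (w - y)) = (v - y) \<bullet> (G x *v (v - y)) - 2 * ((y - v) \<bullet> (G x *v (w - v)))
      + (w - v) \<bullet> (G x *v (w - v))"
  proof -
    have "w - y = (w - v) - (y - v)" "v - y = - (y - v)" by simp_all
    moreover have "(w - v) \<bullet> (G x *v (y - v)) = (y - v) \<bullet> (G x *v (w - v))"
      using inner_matrix_vector_symmetric[OF sym, of "w - v" "y - v"] by (simp add: inner_commute)
    ultimately show ?thesis
      by (simp only: matrix_vector_mult_diff_distrib inner_diff_left inner_diff_right) (simp add: algebra_simps)
  qed
  also have "\<dots> \<ge> (v - y) \<bullet> (G x *v (v - y))"
    using pos normal[OF w] orth by (simp add: matrix_vector_mult_diff_distrib inner_diff_right)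
  finally show "Gnorm (G x) (v - y) \<le> Gnorm (G x) (w - y)" by (simp add: Gnorm_def)
qed

section \<open>Anti-windup trajectories\<close>

lemma right_difference_quotient_le:
  fixes g :: "real \<Rightarrow> real"
  assumes der: "(g has_real_derivative D) (at t within {a..b})" and "a \<le> t" "D \<le> c" and e: "e > 0"
  shows "\<exists>d>0. \<forall>v. t < v \<and> v < t + d \<and> v \<le> b \<longrightarrow> g v - g t \<le> (c + e) * (v - t)"
proof -
  obtain d where d: "d > 0" "\<And>v. v \<in> {a..b} \<Longrightarrow> norm (v - t) < d \<Longrightarrow> norm (g v - g t - D * (v - t)) \<le> e * norm (v - t)"
    using der e unfolding has_field_derivative_def has_derivative_within_alt by blast
  have "g v - g t \<le> (c + e) * (v - t)" if v: "t < v" "v < t + d" "v \<le> b" for v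
  proof -
    have "D * (v - t) \<le> c * (v - t)" using v assms(3) by (intro mult_right_mono) auto
    moreover have "g v - g t - D * (v - t) \<le> e * (v - t)" using d(2)[of v] v assms(2) by (auto simp: abs_le_iff)
    ultimately show ?thesis by (simp add: algebra_simps)
  qed
  with d(1) show ?thesis by blast
qed

lemma has_real_derivative_inner:
  fixes z :: "real \<Rightarrow> 'a::real_inner"
  assumes "(z has_vector_derivative v) F"
  shows "((\<lambda>s. u \<bullet> z s) has_real_derivative u \<bullet> v) F"
proof -
  have "((\<lambda>s. u \<bullet> z s) has_derivative (\<lambda>h. u \<bullet> (h *\<^sub>R v))) F"
    using assms unfolding has_vector_derivative_def by (rule has_derivative_inner_right)
  then show ?thesis unfolding has_field_derivative_def by (rule has_derivative_eq_rhs) (auto simp: mult.commute)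
qed

lemma has_real_derivative_norm_power2:
  fixes z :: "real \<Rightarrow> 'a::real_inner"
  assumes "(z has_vector_derivative v) (at t within S)"
  shows "((\<lambda>s. (norm (z s - p))\<^sup>2) has_real_derivative 2 * ((z t - p) \<bullet> v)) (at t within S)"
proof -
  have "((\<lambda>s. z s - p) has_derivative (\<lambda>h. h *\<^sub>R v)) (at t within S)"
    using assms has_derivative_diff[OF _ has_derivative_const] unfolding has_vector_derivative_def by fastforce
  from has_derivative_inner[OF this this] show ?thesis
    unfolding has_field_derivative_def power2_norm_eq_inner
    by (rule has_derivative_eq_rhs) (auto simp: inner_commute mult.commute)
qed

text \<open>This takes the place of integrating the velocity: for fixed \<open>u\<close> the scalar
  path \<open>u \<bullet> z\<close> is dominated by \<open>z\<close> with constant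
  \<open>norm u\<close>, by Cauchy-Schwarz.\<close>

lemma abs_continuous_inner_increment_le:
  fixes z :: "real \<Rightarrow> real^'n"
  assumes ac: "abs_continuous_on_interval a b z" and ab: "a \<le> b"
    and der: "AE t in lborel. a \<le> t \<and> t < b \<longrightarrow>
        (\<exists>v. (z has_vector_derivative v) (at t within {a..b}) \<and> u \<bullet> v \<le> c)"
  shows "u \<bullet> (z b - z a) \<le> c * (b - a)"
proof -
  have "u \<bullet> z b - u \<bullet> z a \<le> c * (b - a)"
  proof (rule abs_continuous_increment_le[OF ac ab, where C = "norm u" and g = "\<lambda>t. u \<bullet> z t"])
    show "\<bar>u \<bullet> z t - u \<bullet> z s\<bar> \<le> norm u * norm (z t - z s)" for s t
      using Cauchy_Schwarz_ineq2[of u "z t - z s"] by (simp add: inner_diff_right)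
    show "AE t in lborel. a \<le> t \<and> t < b \<longrightarrow>
        (\<forall>e>0. \<exists>d>0. \<forall>v. t < v \<and> v < t + d \<and> v \<le> b \<longrightarrow> u \<bullet> z v - u \<bullet> z t \<le> (c + e) * (v - t))"
      using der
    proof eventually_elim
      case (elim t)
      show ?case
      proof (intro impI allI)
        fix e :: real assume t: "a \<le> t \<and> t < b" and e: "e > 0"
        then obtain v where v: "(z has_vector_derivative v) (at t within {a..b})" "u \<bullet> v \<le> c" using elim by blast
        show "\<exists>d>0. \<forall>v. t < v \<and> v < t + d \<and> v \<le> b \<longrightarrow> u \<bullet> z v - u \<bullet> z t \<le> (c + e) * (v - t)"
          using right_difference_quotient_le[OF has_real_derivative_inner[OF v(1)] _ v(2) e] t by blast
      qed
    qed
  qed simp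
  then show ?thesis by (simp add: inner_diff_right)
qed

text \<open>The parameter \<open>K\<close> stays outside, so that all members of the sequence obey
  estimates with the same constants.\<close>

locale anti_windup_bounds =
  fixes Z :: "(real^'n) set"
    and f :: "real^'n \<Rightarrow> real^'n \<Rightarrow> real^'n"
    and G :: "real^'n \<Rightarrow> real^'n^'n"
    and z0 :: "real^'n"
    and M \<nu> \<mu> \<alpha> \<epsilon> :: real
  assumes G_spd: "\<forall>x\<in>Z. sym_pos_def (G x)"
    and z0_in: "z0 \<in> Z"
    and pos: "M > 0" "\<nu> > 0" "\<mu> > 0" "\<alpha> > 0" "\<epsilon> > 0"
    and bound_f: "\<forall>z\<in>cball z0 \<epsilon> \<inter> inflated Z \<alpha>. \<forall>p\<in>proj_set Z z. norm (f z p) \<le> M"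
    and bound_G: "\<forall>z\<in>cball z0 \<epsilon> \<inter> inflated Z \<alpha>. \<forall>p\<in>proj_set Z z.
                    loewner_le (\<mu> *\<^sub>R mat 1) (matrix_inv (G p)) \<and>
                    loewner_le (matrix_inv (G p)) (\<nu> *\<^sub>R mat 1)"
begin

text \<open>All conclusions refer to the one projection \<open>p\<close> selected by the inclusion.
  The lower Loewner bound makes the correction pull toward \<open>Z\<close> at rate
  \<open>\<mu> / K\<close>; the upper bound caps its size.\<close>

lemma anti_windup_velocityE:
  assumes v: "v \<in> anti_windup Z f G K z" and K: "K > 0" and z: "z \<in> cball z0 \<epsilon>" "infdist z Z < 1 / (2 * \<alpha>)"
  obtains p where "p \<in> proj_set Z z" "norm (f z p) \<le> M"
    "v = f z p - (1 / K) *\<^sub>R (matrix_inv (G p) *v (z - p))"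
    "(z - p) \<bullet> v \<le> infdist z Z * (M - \<mu> / K * infdist z Z)"
    "norm v \<le> M + \<nu> / K * infdist z Z"
proof -
  obtain p where p: "p \<in> proj_set Z z" and veq: "v = f z p - (1 / K) *\<^sub>R (matrix_inv (G p) *v (z - p))"
    using v unfolding anti_windup_def by blast
  let ?A = "matrix_inv (G p)" and ?d = "infdist z Z"
  have zi: "z \<in> cball z0 \<epsilon> \<inter> inflated Z \<alpha>" using z inflated_if_infdist_less[OF p] by blast
  have fM: "norm (f z p) \<le> M" using bound_f zi p by blast
  have low: "\<mu> * (u \<bullet> u) \<le> u \<bullet> (?A *v u)" for u
    using bound_G zi p by (auto simp: loewner_le_def scaleR_matrix_vector_assoc[symmetric])
  have sym: "transpose ?A = ?A" using G_spd proj_setD(1)[OF p] sym_pos_def_inverse(2) by blast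
  have dn: "norm (z - p) = ?d" by (rule proj_setD(3)[OF p])
  have "(z - p) \<bullet> v = (z - p) \<bullet> f z p - (1 / K) * ((z - p) \<bullet> (?A *v (z - p)))"
    by (simp add: veq inner_diff_right)
  also have "\<dots> \<le> ?d * M - (1 / K) * (\<mu> * (?d * ?d))"
  proof (rule diff_mono)
    have "(z - p) \<bullet> f z p \<le> norm (z - p) * norm (f z p)" by (rule norm_cauchy_schwarz)
    also have "\<dots> \<le> ?d * M" using fM dn by (simp add: mult_left_mono infdist_nonneg)
    finally show "(z - p) \<bullet> f z p \<le> ?d * M" .
    show "(1 / K) * (\<mu> * (?d * ?d)) \<le> (1 / K) * ((z - p) \<bullet> (?A *v (z - p)))"
      using low[of "z - p"] K by (intro mult_left_mono) (auto simp: dot_square_norm dn power2_eq_square)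
  qed
  finally have *: "(z - p) \<bullet> v \<le> ?d * (M - \<mu> / K * ?d)" by (simp add: algebra_simps)
  have "norm (?A *v (z - p)) \<le> \<nu> * norm (z - p)"
  proof (rule norm_matrix_vector_le_of_loewner_le[OF sym])
    show "0 \<le> u \<bullet> (?A *v u)" for u
      using low[of u] pos by (meson inner_ge_zero mult_nonneg_nonneg less_imp_le order_trans)
  qed (use bound_G zi p pos in blast)+
  then have "norm ((1 / K) *\<^sub>R (?A *v (z - p))) \<le> (1 / K) * (\<nu> * ?d)"
    using K dn by (simp add: divide_right_mono)
  then have "norm v \<le> M + \<nu> / K * ?d"
    using norm_triangle_ineq4[of "f z p" "(1 / K) *\<^sub>R (?A *v (z - p))"] fM by (simp add: veq)
  with p fM veq * show thesis by (rule that)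
qed

text \<open>The truncation of the squared distance between \<open>(K M / \<mu>)\<^sup>2\<close> and \<open>\<eta>\<^sup>2\<close> is nonincreasing: the
  velocity estimate applies in between, and outside of this range the function is locally constant.\<close>
lemma infdist_truncated_sol_le:
  assumes K: "K > 0" and sol: "truncated_sol (anti_windup Z f G K) T \<epsilon> z0 T' z"
    and small: "K * M / \<mu> < 1 / (2 * \<alpha>)" and t: "t \<in> {0..T'}"
  shows "infdist (z t) Z \<le> K * M / \<mu>"
proof -
  define D where "D = K * M / \<mu>"
  define d where "d s = infdist (z s) Z" for s
  \<comment> \<open>The cut \<open>\<eta>\<close> lies below the tube radius, so states outside the
    tube fall where the truncation is already maximal.\<close>
  obtain \<eta> where \<eta>: "D < \<eta>" "\<eta> < 1 / (2 * \<alpha>)" using small dense unfolding D_def by blast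
  have D0: "D \<ge> 0" using K pos by (simp add: D_def)
  define g where "g s = max (D\<^sup>2) (min ((d s)\<^sup>2) (\<eta>\<^sup>2))" for s
  have d0: "d s \<ge> 0" for s by (simp add: d_def infdist_nonneg)
  have ac: "abs_continuous_on_interval 0 T' z" and z_0: "z 0 = z0"
    and inball: "\<And>s. s \<in> {0..T'} \<Longrightarrow> z s \<in> cball z0 \<epsilon>"
    and ae: "AE t in lborel. t \<in> {0..T'} \<longrightarrow>
        (\<exists>v. (z has_vector_derivative v) (at t within {0..T'}) \<and> v \<in> anti_windup Z f G K (z t))"
    using sol by (auto simp: truncated_sol_def caratheodory_sol_def)
  have ac': "abs_continuous_on_interval 0 t z"
    using ac t by (intro abs_continuous_on_interval_subinterval[OF ac]) auto
  \<comment> \<open>As \<open>z0\<close> lies in \<open>Z\<close>, the ball constraint bounds the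
    distance by \<open>\<epsilon>\<close>; this yields the constant \<open>2 * \<epsilon>\<close>
    for the difference of squares below.\<close>
  have d_le: "d s \<le> \<epsilon>" if "s \<in> {0..T'}" for s
    using inball[OF that] infdist_le[OF z0_in, of "z s"] by (simp add: d_def dist_commute)
  have cont_d: "continuous_on {0..T'} d"
    unfolding d_def using abs_continuous_on_interval_imp_continuous_on[OF ac]
    by (intro continuous_on_infdist)
  have "g t - g 0 \<le> 0 * (t - 0)"
  proof (rule abs_continuous_increment_le[OF ac', where C = "2 * \<epsilon>"])
    show "0 \<le> t" "0 \<le> 2 * \<epsilon>" using t pos by auto
    fix r s assume rs: "0 \<le> r" "r \<le> s" "s \<le> t"
    have "\<bar>g s - g r\<bar> \<le> \<bar>(d s)\<^sup>2 - (d r)\<^sup>2\<bar>" by (auto simp: g_def max_def min_def)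
    also have "\<dots> = \<bar>d s - d r\<bar> * (d s + d r)"
      using d0[of s] d0[of r] by (simp add: power2_eq_square square_diff_square_factored abs_mult)
    also have "\<dots> \<le> norm (z s - z r) * (2 * \<epsilon>)"
      using infdist_triangle_abs[of "z s" Z "z r"] d_le[of s] d_le[of r] rs t d0[of s] d0[of r]
      by (intro mult_mono) (auto simp: d_def dist_norm)
    finally show "\<bar>g s - g r\<bar> \<le> 2 * \<epsilon> * norm (z s - z r)" by (simp add: mult.commute)
  next
    show "AE s in lborel. 0 \<le> s \<and> s < t \<longrightarrow>
        (\<forall>e>0. \<exists>\<delta>>0. \<forall>v. s < v \<and> v < s + \<delta> \<and> v \<le> t \<longrightarrow> g v - g s \<le> (0 + e) * (v - s))"
      using ae
    proof eventually_elim
      case (elim s)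
      show ?case
      proof (intro impI allI)
        fix e :: real assume s: "0 \<le> s \<and> s < t" and e: "e > 0"
        then have sT: "s \<in> {0..T'}" using t by auto
        have near: "\<exists>\<delta>>0. \<forall>v. s < v \<and> v < s + \<delta> \<and> v \<le> t \<longrightarrow> \<bar>d v - d s\<bar> < r" if r: "r > 0" for r
        proof -
          obtain \<delta> where "\<delta> > 0" "\<forall>v\<in>{0..T'}. dist v s < \<delta> \<longrightarrow> dist (d v) (d s) < r"
            using cont_d sT r unfolding continuous_on_iff by blast
          then show ?thesis using s t by (intro exI[of _ \<delta>]) (auto simp: dist_real_def)
        qed
        \<comment> \<open>The last two cases overlap, so that the boundary value
          \<open>d s = \<eta>\<close> is covered by the velocity estimate.\<close>
        consider "d s < D" | "D \<le> d s" "d s < 1 / (2 * \<alpha>)" | "\<eta> < d s" using \<eta> by linarith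
        then show "\<exists>\<delta>>0. \<forall>v. s < v \<and> v < s + \<delta> \<and> v \<le> t \<longrightarrow> g v - g s \<le> (0 + e) * (v - s)"
        proof cases
          case 1
          then obtain \<delta> where \<delta>: "\<delta> > 0" "\<And>v. s < v \<Longrightarrow> v < s + \<delta> \<Longrightarrow> v \<le> t \<Longrightarrow> \<bar>d v - d s\<bar> < D - d s"
            using near[of "D - d s"] by auto
          have "g v - g s \<le> (0 + e) * (v - s)" if v: "s < v" "v < s + \<delta>" "v \<le> t" for v
          proof -
            have "(d v)\<^sup>2 \<le> D\<^sup>2" using \<delta>(2)[OF v] d0[of v] by (intro power_mono) auto
            then have "g v \<le> g s" by (simp add: g_def)
            with e v show ?thesis by (smt (verit) mult_nonneg_nonneg)
          qed
          with \<delta>(1) show ?thesis by blast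
        next
          case 3
          have "g v - g s \<le> (0 + e) * (v - s)" if v: "s < v" for v
          proof -
            have "\<eta>\<^sup>2 \<le> (d s)\<^sup>2" using 3 \<eta>(1) D0 by (intro power_mono) auto
            then have "g v \<le> g s" by (simp add: g_def)
            with e v show ?thesis by (smt (verit) mult_nonneg_nonneg)
          qed
          then show ?thesis by (intro exI[of _ 1]) auto
        next
          case 2
          obtain v where v: "(z has_vector_derivative v) (at s within {0..T'})" "v \<in> anti_windup Z f G K (z s)"
            using elim sT by blast
          obtain p where p: "p \<in> proj_set Z (z s)"
            and le: "(z s - p) \<bullet> v \<le> infdist (z s) Z * (M - \<mu> / K * infdist (z s) Z)"
            by (rule anti_windup_velocityE[OF v(2) K inball[OF sT]]) (use 2 in \<open>auto simp: d_def\<close>)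
          have "M - \<mu> / K * d s \<le> 0" using 2(1) K pos by (simp add: D_def field_simps)
          then have "d s * (M - \<mu> / K * d s) \<le> 0" using d0 by (rule mult_nonneg_nonpos[rotated])
          then have "(z s - p) \<bullet> v \<le> 0" using le unfolding d_def by (rule order_trans[rotated])
          then have "2 * ((z s - p) \<bullet> v) \<le> 0" by simp
          \<comment> \<open>The projection \<open>p\<close> is frozen at time \<open>s\<close>: the
            squared distance to it dominates \<open>(d r)\<^sup>2\<close> and equals
            \<open>(d s)\<^sup>2\<close> at \<open>s\<close>.\<close>
          from right_difference_quotient_le[OF has_real_derivative_norm_power2[OF v(1), of p] _ this e] sT
          obtain \<delta> where \<delta>: "\<delta> > 0" "\<And>r. s < r \<Longrightarrow> r < s + \<delta> \<Longrightarrow> r \<le> T' \<Longrightarrow>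
             (norm (z r - p))\<^sup>2 - (norm (z s - p))\<^sup>2 \<le> (0 + e) * (r - s)" by auto
          have "g r - g s \<le> (0 + e) * (r - s)" if r: "s < r" "r < s + \<delta>" "r \<le> t" for r
          proof -
            have "d r \<le> norm (z r - p)"
              using infdist_le[OF proj_setD(1)[OF p], of "z r"] by (simp add: d_def dist_norm)
            then have "(d r)\<^sup>2 \<le> (norm (z r - p))\<^sup>2" using d0[of r] by (intro power_mono)
            moreover have "(d s)\<^sup>2 = (norm (z s - p))\<^sup>2" by (simp add: d_def proj_setD(3)[OF p])
            ultimately have "(d r)\<^sup>2 - (d s)\<^sup>2 \<le> e * (r - s)" using \<delta>(2)[of r] r t by auto
            moreover have "0 \<le> e * (r - s)" using e r by simp
            ultimately show ?thesis by (auto simp: g_def max_def min_def)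
          qed
          with \<delta>(1) show ?thesis by blast
        qed
      qed
    qed
  qed
  moreover have "g 0 = D\<^sup>2" using z0_in by (simp add: g_def d_def z_0)
  ultimately have "min ((d t)\<^sup>2) (\<eta>\<^sup>2) \<le> D\<^sup>2" by (simp add: g_def)
  \<comment> \<open>With \<open>D < \<eta>\<close>, the minimum can be at most
    \<open>D\<^sup>2\<close> only through the distance, which excludes escape from the tube.\<close>
  moreover have "D\<^sup>2 < \<eta>\<^sup>2" using D0 \<eta>(1) by (intro power_strict_mono) auto
  ultimately have "(d t)\<^sup>2 \<le> D\<^sup>2" by auto
  then have "d t \<le> D" using D0 by (rule power2_le_imp_le)
  then show ?thesis by (simp add: d_def D_def)
qed

text \<open>Testing the increment against its own direction \<open>z t - z s\<close> makes the
  problem scalar, and one factor of the norm cancels. In the speed bound \<open>\<nu> / K\<close>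
  meets a distance of at most \<open>K * M / \<mu>\<close>, so the constant is independent of
  \<open>K\<close>.\<close>

lemma truncated_sol_lipschitz:
  assumes K: "K > 0" and sol: "truncated_sol (anti_windup Z f G K) T \<epsilon> z0 T' z"
    and small: "K * M / \<mu> < 1 / (2 * \<alpha>)" and st: "0 \<le> s" "s \<le> t" "t \<le> T'"
  shows "norm (z t - z s) \<le> (M + \<nu> * M / \<mu>) * (t - s)"
proof -
  let ?L = "M + \<nu> * M / \<mu>"
  have ac: "abs_continuous_on_interval 0 T' z"
    and inball: "\<And>s. s \<in> {0..T'} \<Longrightarrow> z s \<in> cball z0 \<epsilon>"
    and ae: "AE t in lborel. t \<in> {0..T'} \<longrightarrow>
        (\<exists>v. (z has_vector_derivative v) (at t within {0..T'}) \<and> v \<in> anti_windup Z f G K (z t))"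
    using sol by (auto simp: truncated_sol_def caratheodory_sol_def)
  let ?u = "z t - z s"
  have "?u \<bullet> (z t - z s) \<le> (norm ?u * ?L) * (t - s)"
  proof (rule abs_continuous_inner_increment_le)
    show "abs_continuous_on_interval s t z" using st by (intro abs_continuous_on_interval_subinterval[OF ac]) auto
    show "AE r in lborel. s \<le> r \<and> r < t \<longrightarrow>
        (\<exists>v. (z has_vector_derivative v) (at r within {s..t}) \<and> ?u \<bullet> v \<le> norm ?u * ?L)"
      using ae
    proof eventually_elim
      case (elim r)
      show ?case
      proof
        assume r: "s \<le> r \<and> r < t"
        then have rT: "r \<in> {0..T'}" using st by auto
        then obtain v where v: "(z has_vector_derivative v) (at r within {0..T'})" "v \<in> anti_windup Z f G K (z r)"
          using elim by blast
        have d: "infdist (z r) Z \<le> K * M / \<mu>" by (rule infdist_truncated_sol_le[OF K sol small rT])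
        have "norm v \<le> M + \<nu> / K * infdist (z r) Z"
          by (rule anti_windup_velocityE[OF v(2) K inball[OF rT]]) (use d small in auto)
        also have "\<dots> \<le> M + \<nu> / K * (K * M / \<mu>)" using d K pos by (intro add_left_mono mult_left_mono) auto
        finally have "norm v \<le> ?L" using K by simp
        then have "?u \<bullet> v \<le> norm ?u * ?L"
          using norm_cauchy_schwarz[of ?u v] by (meson mult_left_mono norm_ge_zero order_trans)
        moreover have "(z has_vector_derivative v) (at r within {s..t})"
          using st by (intro has_vector_derivative_within_subset[OF v(1)]) auto
        ultimately show "\<exists>v. (z has_vector_derivative v) (at r within {s..t}) \<and> ?u \<bullet> v \<le> norm ?u * ?L" by blast
      qed
    qed
  qed (use st in auto)
  then have "norm ?u * norm ?u \<le> norm ?u * (?L * (t - s))"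
    by (simp add: dot_square_norm power2_eq_square algebra_simps)
  moreover have "0 \<le> ?L * (t - s)" using pos st by simp
  ultimately show ?thesis by (cases "norm ?u = 0") (auto simp: mult_le_cancel_left)
qed

text \<open>At \<open>p\<close> itself, \<open>(f z p - v) \<bullet> (G p *v w)\<close> is exactly
  \<open>(1 / K) * ((z - p) \<bullet> w)\<close>, because the metric cancels its inverse. Replacing
  \<open>w\<close> by a tangent vector at \<open>p\<close> costs \<open>M / \<mu>\<close> times
  \<open>e\<close>; the other summands of the constant pay for moving \<open>f z p\<close> to
  \<open>y\<close> and \<open>G p *v w\<close> to \<open>g\<close>.\<close>

lemma anti_windup_velocity_normal_le:
  assumes v: "v \<in> anti_windup Z f G K z" and K: "K > 0" and z: "z \<in> cball z0 \<epsilon>"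
    and d: "infdist z Z \<le> K * M / \<mu>" and small: "K * M / \<mu> < 1 / (2 * \<alpha>)"
    and e: "e > 0"
    and near: "\<And>p. p \<in> proj_set Z z \<Longrightarrow> (\<exists>w'\<in>tangent_cone Z p. dist w' w < e) \<and>
        dist (f z p) y < e \<and> dist (G p *v w) g < e"
  shows "(y - v) \<bullet> g \<le> (M / \<mu> + norm g + 2 * M + \<nu> * M / \<mu>) * e"
proof -
  have "infdist z Z < 1 / (2 * \<alpha>)" using d small by simp
  with v K z obtain p where p: "p \<in> proj_set Z z" "norm (f z p) \<le> M"
    "v = f z p - (1 / K) *\<^sub>R (matrix_inv (G p) *v (z - p))" "norm v \<le> M + \<nu> / K * infdist z Z"
    by (rule anti_windup_velocityE)
  note pZ = proj_setD(1)[OF p(1)]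
  note spd = G_spd[rule_format, OF pZ]
  have dn: "norm (z - p) \<le> K * M / \<mu>" using d proj_setD(3)[OF p(1)] by simp
  have "norm v \<le> M + \<nu> / K * (K * M / \<mu>)"
    using p(4) d K pos by (meson add_left_mono divide_nonneg_pos less_imp_le mult_left_mono order_trans)
  then have nv: "norm v \<le> M + \<nu> * M / \<mu>" using K by simp
  obtain w' where w': "w' \<in> tangent_cone Z p" "dist w' w < e" using near[OF p(1)] by blast
  have f: "norm (y - f z p) \<le> e" and g: "norm (G p *v w - g) \<le> e"
    using near[OF p(1)] by (auto simp: dist_norm norm_minus_commute)
  have "(f z p - v) \<bullet> (G p *v w) = (1 / K) * ((z - p) \<bullet> w)"
  proof -
    have "(matrix_inv (G p) *v (z - p)) \<bullet> (G p *v w) = (z - p) \<bullet> w"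
      using inner_matrix_vector_symmetric[of "G p" "matrix_inv (G p) *v (z - p)" w] spd
        sym_pos_def_inverse(1)[OF spd, of "z - p"] by (simp add: sym_pos_def_def)
    then show ?thesis by (simp add: p(3))
  qed
  also have "\<dots> \<le> (1 / K) * ((K * M / \<mu>) * e)"
  proof (rule mult_left_mono)
    have "(z - p) \<bullet> w' \<le> 0"
      using proximal_normal_in_normal_cone[OF p(1)] w'(1) unfolding normal_cone_def by blast
    then have "(z - p) \<bullet> w \<le> (z - p) \<bullet> (w - w')" by (simp add: inner_diff_right)
    also have "\<dots> \<le> norm (z - p) * norm (w - w')" by (rule norm_cauchy_schwarz)
    also have "\<dots> \<le> (K * M / \<mu>) * e"
      using dn w'(2) K pos by (intro mult_mono) (auto simp: dist_norm norm_minus_commute)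
    finally show "(z - p) \<bullet> w \<le> (K * M / \<mu>) * e" .
  qed (use K in simp)
  also have "\<dots> = M / \<mu> * e" using K by simp
  finally have 1: "(f z p - v) \<bullet> (G p *v w) \<le> M / \<mu> * e" .
  have 2: "(y - f z p) \<bullet> g \<le> norm g * e"
  proof -
    have "(y - f z p) \<bullet> g \<le> norm (y - f z p) * norm g" by (rule norm_cauchy_schwarz)
    also have "\<dots> \<le> e * norm g" using f by (rule mult_right_mono) simp
    finally show ?thesis by (simp add: mult.commute)
  qed
  have 3: "- ((f z p - v) \<bullet> (G p *v w - g)) \<le> (2 * M + \<nu> * M / \<mu>) * e"
  proof -
    have "norm (f z p - v) \<le> 2 * M + \<nu> * M / \<mu>"
      using norm_triangle_ineq4[of "f z p" v] p(2) nv by linarith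
    moreover have "- ((f z p - v) \<bullet> (G p *v w - g)) \<le> norm (f z p - v) * norm (G p *v w - g)"
      using Cauchy_Schwarz_ineq2[of "f z p - v" "G p *v w - g"] by linarith
    moreover have "norm (f z p - v) * norm (G p *v w - g) \<le> norm (f z p - v) * e"
      using g by (rule mult_left_mono) simp
    ultimately show ?thesis using e by (meson less_imp_le mult_right_mono order_trans)
  qed
  have "(y - v) \<bullet> g = (y - f z p) \<bullet> g + (f z p - v) \<bullet> (G p *v w) + - ((f z p - v) \<bullet> (G p *v w - g))"
    by (simp add: inner_diff_left inner_diff_right)
  also have "\<dots> \<le> norm g * e + M / \<mu> * e + (2 * M + \<nu> * M / \<mu>) * e"
    using 1 2 3 by linarith
  finally show ?thesis by (simp add: algebra_simps)
qed

text \<open>Clarke regularity carries the approximate normality of the correction terms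
  \<open>(z - p) / K\<close> to the limit point. The estimate is integrated over \<open>[t, t + h]\<close> before passing to
  the limit, so that no weak convergence of velocities is needed.\<close>
lemma limit_velocity_normal:
  assumes regular: "clarke_regular Z"
    and f_cont: "continuous_on (UNIV \<times> Z) (\<lambda>(z, p). f z p)"
    and G_cont: "continuous_on Z G"
    and K: "\<And>i. K i > 0" "K \<longlonglongrightarrow> 0" and small: "\<And>i. K i * M / \<mu> < 1 / (2 * \<alpha>)"
    and sol: "\<And>i. truncated_sol (anti_windup Z f G (K i)) T \<epsilon> z0 (Ts i) (zs i)"
    and t: "0 \<le> t" and h0: "h0 > 0" and long: "\<forall>\<^sub>F i in sequentially. t + h0 \<le> Ts i"
    and lim: "\<And>s. s \<in> {t..t + h0} \<Longrightarrow> (\<lambda>i. zs i s) \<longlonglongrightarrow> y s"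
    and der: "(y has_vector_derivative v) (at t)"
    and x: "y t \<in> Z" and w: "w \<in> tangent_cone Z (y t)"
  shows "(f (y t) (y t) - v) \<bullet> (G (y t) *v w) \<le> 0"
proof -
  define x where "x = y t"
  define g where "g = G x *v w"
  define L where "L = M + \<nu> * M / \<mu>"
  have L: "L > 0" using pos by (simp add: L_def add_pos_pos)
  define C where "C = M / \<mu> + norm g + 2 * M + \<nu> * M / \<mu>"
  have C: "C > 0" unfolding C_def using pos by (intro add_pos_pos add_pos_nonneg) auto
  have xZ: "x \<in> Z" using x by (simp add: x_def)
  have main: "(f x x - v) \<bullet> g \<le> C * e" if e: "e > 0" for e
  proof -
    obtain d1 where d1: "d1 > 0" "\<And>p. p \<in> Z \<Longrightarrow> dist p x < d1 \<Longrightarrow> \<exists>w'\<in>tangent_cone Z p. dist w' w < e"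
      using clarke_regular_nearby_tangents[OF regular xZ w[folded x_def] e] by blast
    have "\<exists>d>0. \<forall>q\<in>UNIV \<times> Z. dist q (x, x) < d \<longrightarrow> dist (case q of (z, p) \<Rightarrow> f z p) (case (x, x) of (z, p) \<Rightarrow> f z p) < e"
      using f_cont xZ e unfolding continuous_on_iff by (metis UNIV_I mem_Sigma_iff)
    then obtain d2 where d2: "d2 > 0" "\<And>z p. p \<in> Z \<Longrightarrow> dist (z, p) (x, x) < d2 \<Longrightarrow> dist (f z p) (f x x) < e"
      by force
    have "continuous_on Z (\<lambda>p. G p *v w)"
      unfolding matrix_vector_mult_def
      by (intro continuous_on_vec_lambda continuous_intros G_cont)
    then obtain d3 where d3: "d3 > 0" "\<And>p. p \<in> Z \<Longrightarrow> dist p x < d3 \<Longrightarrow> dist (G p *v w) g < e"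
      using xZ e unfolding continuous_on_iff g_def by meson
    \<comment> \<open>Half of \<open>d2\<close> is taken because the distance in the product is
      bounded by the sum of the two component distances.\<close>
    define d where "d = min d1 (min (d2 / 2) d3)"
    have d: "d > 0" "d \<le> d1" "2 * d \<le> d2" "d \<le> d3" using d1 d2 d3 by (auto simp: d_def)
    \<comment> \<open>Distance budget: a quarter of \<open>d\<close> each for the position at time
      \<open>t\<close>, the motion during \<open>h1\<close>, and the gap to the projection, which
      keeps \<open>p\<close> within \<open>d\<close> of \<open>x\<close>.\<close>
    define h1 where "h1 = min h0 (d / (4 * L))"
    have h1: "h1 > 0" "h1 \<le> h0" "L * h1 \<le> d / 4"
      using h0 d(1) L by (auto simp: h1_def min_def field_simps)
    have ev: "\<forall>\<^sub>F i in sequentially. dist (zs i t) x < d / 4 \<and> K i * M / \<mu> < d / 4 \<and> t + h0 \<le> Ts i"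
    proof (intro eventually_conj long)
      have "(\<lambda>i. zs i t) \<longlonglongrightarrow> x" unfolding x_def using lim[of t] h0 by simp
      then show "\<forall>\<^sub>F i in sequentially. dist (zs i t) x < d / 4" using d(1) by (intro tendstoD) auto
      have "(\<lambda>i. K i * M / \<mu>) \<longlonglongrightarrow> 0 * M / \<mu>" using pos by (intro tendsto_intros K) auto
      then show "\<forall>\<^sub>F i in sequentially. K i * M / \<mu> < d / 4" using d(1) by (intro order_tendstoD) auto
    qed
    \<comment> \<open>The increment lemma bounds from above, hence the test vector
      \<open>- g\<close>; the rate is the normality estimate solved for the velocity term.\<close>
    have incr: "(- g) \<bullet> (y (t + h) - y t) \<le> (C * e - f x x \<bullet> g) * h" if h: "0 < h" "h \<le> h1" for h
    proof (rule tendsto_upperbound)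
      show "(\<lambda>i. (- g) \<bullet> (zs i (t + h) - zs i t)) \<longlonglongrightarrow> (- g) \<bullet> (y (t + h) - y t)"
        using h h1 h0 by (intro tendsto_intros lim) auto
      show "\<forall>\<^sub>F i in sequentially. (- g) \<bullet> (zs i (t + h) - zs i t) \<le> (C * e - f x x \<bullet> g) * h"
        using ev
      proof eventually_elim
        case (elim i)
        have hT: "t + h \<le> Ts i" using elim h h1 by simp
        have ac: "abs_continuous_on_interval 0 (Ts i) (zs i)"
          and inball: "\<And>s. s \<in> {0..Ts i} \<Longrightarrow> zs i s \<in> cball z0 \<epsilon>"
          and ae: "AE s in lborel. s \<in> {0..Ts i} \<longrightarrow>
              (\<exists>v. (zs i has_vector_derivative v) (at s within {0..Ts i}) \<and> v \<in> anti_windup Z f G (K i) (zs i s))"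
          using sol[of i] by (auto simp: truncated_sol_def caratheodory_sol_def)
        have "(- g) \<bullet> (zs i (t + h) - zs i t) \<le> (C * e - f x x \<bullet> g) * ((t + h) - t)"
        proof (rule abs_continuous_inner_increment_le)
          show "abs_continuous_on_interval t (t + h) (zs i)"
            using t hT by (intro abs_continuous_on_interval_subinterval[OF ac]) auto
          show "t \<le> t + h" using h by simp
          show "AE s in lborel. t \<le> s \<and> s < t + h \<longrightarrow>
            (\<exists>v. (zs i has_vector_derivative v) (at s within {t..t + h}) \<and> (- g) \<bullet> v \<le> C * e - f x x \<bullet> g)"
            using ae
          proof eventually_elim
            case (elim s)
            show ?case
            proof
              assume s: "t \<le> s \<and> s < t + h"
              then have sT: "s \<in> {0..Ts i}" using t hT by auto
              then obtain v where v: "(zs i has_vector_derivative v) (at s within {0..Ts i})"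
                "v \<in> anti_windup Z f G (K i) (zs i s)" using elim by blast
              have dd: "infdist (zs i s) Z \<le> K i * M / \<mu>"
                by (rule infdist_truncated_sol_le[OF K(1) sol small sT])
              have "norm (zs i s - zs i t) \<le> L * (s - t)"
                unfolding L_def using s t sT by (intro truncated_sol_lipschitz[OF K(1) sol small]) auto
              also have "\<dots> \<le> L * h1" using s h L by (intro mult_left_mono) auto
              also have "\<dots> \<le> d / 4" by (rule h1)
              finally have zx: "dist (zs i s) x < d / 2"
                using \<open>dist (zs i t) x < d / 4 \<and> _\<close> dist_triangle[of "zs i s" x "zs i t"] by (simp add: dist_norm)
              have "(f x x - v) \<bullet> g \<le> (M / \<mu> + norm g + 2 * M + \<nu> * M / \<mu>) * e"
              proof (rule anti_windup_velocity_normal_le[OF v(2) K(1) inball[OF sT] dd small e])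
                fix p assume p: "p \<in> proj_set Z (zs i s)"
                have "dist p x < d"
                  using proj_setD(2)[OF p] dd zx \<open>dist (zs i t) x < d / 4 \<and> _\<close> d(1)
                    dist_triangle3[of p x "zs i s"] by linarith
                moreover have "dist (zs i s, p) (x, x) < d2"
                proof -
                  have "dist (zs i s, p) (x, x) \<le> dist (zs i s) x + dist p x"
                    unfolding dist_prod_def by (simp add: sqrt_sum_squares_le_sum)
                  with zx \<open>dist p x < d\<close> d show ?thesis by linarith
                qed
                ultimately show "(\<exists>w'\<in>tangent_cone Z p. dist w' w < e) \<and>
                    dist (f (zs i s) p) (f x x) < e \<and> dist (G p *v w) g < e"
                  using d1(2) d2(2) d3(2) proj_setD(1)[OF p] d by (meson less_le_trans)
              qed
              then have "(- g) \<bullet> v \<le> C * e - f x x \<bullet> g"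
                by (simp add: C_def inner_diff_left inner_diff_right inner_commute)
              moreover have "(zs i has_vector_derivative v) (at s within {t..t + h})"
                using t hT by (intro has_vector_derivative_within_subset[OF v(1)]) auto
              ultimately show "\<exists>v. (zs i has_vector_derivative v) (at s within {t..t + h}) \<and> (- g) \<bullet> v \<le> C * e - f x x \<bullet> g"
                by blast
            qed
          qed
        qed
        then show ?case by simp
      qed
    qed simp
    have "((\<lambda>s. (- g) \<bullet> y s) has_real_derivative (- g) \<bullet> v) (at t)"
      using der by (rule has_real_derivative_inner)
    then have "((\<lambda>h. ((- g) \<bullet> y (t + h) - (- g) \<bullet> y t) / h) \<longlongrightarrow> (- g) \<bullet> v) (at_right 0)"
      unfolding DERIV_def by (rule filterlim_mono) (auto intro: at_le)
    then have "(- g) \<bullet> v \<le> C * e - f x x \<bullet> g"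
    proof (rule tendsto_upperbound)
      show "\<forall>\<^sub>F h in at_right 0. ((- g) \<bullet> y (t + h) - (- g) \<bullet> y t) / h \<le> C * e - f x x \<bullet> g"
        unfolding eventually_at_right_field
        using incr h1(1) by (intro exI[of _ h1]) (auto simp: inner_diff_right pos_divide_le_eq)
    qed simp
    then show ?thesis by (simp add: inner_diff_left inner_diff_right inner_commute)
  qed
  have "(f x x - v) \<bullet> g \<le> 0"
  proof (rule field_le_epsilon)
    fix e :: real assume "e > 0"
    then show "(f x x - v) \<bullet> g \<le> 0 + e" using main[of "e / C"] C by simp
  qed
  then show ?thesis by (simp add: x_def g_def)
qed

end

section \<open>Limits of trajectories\<close>

text \<open>The common Lipschitz constant supplies equicontinuity. Only pointwise limits are kept; a
  Lipschitz bound later upgrades them to convergence along moving times.\<close>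

lemma lipschitz_Arzela_Ascoli:
  fixes Y :: "nat \<Rightarrow> real \<Rightarrow> real^'n"
  assumes bound: "\<And>i s. s \<in> {0..T} \<Longrightarrow> norm (Y i s) \<le> B"
    and lip: "\<And>i s t. norm (Y i t - Y i s) \<le> L * \<bar>t - s\<bar>"
  shows "\<exists>g k. strict_mono (k :: nat \<Rightarrow> nat) \<and> (\<forall>s\<in>{0..T}. (\<lambda>i. Y (k i) s) \<longlonglongrightarrow> g s)"
proof -
  obtain g k where gk: "strict_mono (k :: nat \<Rightarrow> nat)"
    "\<And>e. 0 < e \<Longrightarrow> \<exists>N. \<forall>n x. n \<ge> N \<and> x \<in> {0..T} \<longrightarrow> norm (Y (k n) x - g x) < e"
  proof (rule Arzela_Ascoli[of "{0..T}" Y B])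
    fix x e :: real assume e: "0 < e"
    define d where "d = e / (\<bar>L\<bar> + 1)"
    have d: "d > 0" "\<bar>L\<bar> * d < e" using e by (auto simp: d_def field_simps)
    have "norm (Y n x - Y n y) < e" if "norm (x - y) < d" for n y
    proof -
      have "norm (Y n x - Y n y) \<le> \<bar>L\<bar> * \<bar>x - y\<bar>"
        using lip[of n x y] abs_ge_self[of L] by (meson abs_ge_zero mult_right_mono order_trans)
      also have "\<dots> \<le> \<bar>L\<bar> * d" using that by (intro mult_left_mono) auto
      finally show ?thesis using d(2) by simp
    qed
    with d(1) show "\<exists>d>0. \<forall>n y. y \<in> {0..T} \<and> norm (x - y) < d \<longrightarrow> norm (Y n x - Y n y) < e" by blast
  qed (use bound in auto)
  have "(\<lambda>i. Y (k i) s) \<longlonglongrightarrow> g s" if "s \<in> {0..T}" for s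
    unfolding LIMSEQ_iff using gk(2) that by blast
  with gk(1) show ?thesis by (intro exI conjI ballI)
qed

text \<open>Moving times fit the varying interval lengths: \<open>min t (Ts i)\<close> is always
  admissible and approximates each point of the limit graph, while points selected for the outer
  limit carry their own moving times.\<close>

lemma graph_converges_if_convergent_along_times:
  assumes Ts: "\<And>i. 0 \<le> Ts i" "Ts \<longlonglongrightarrow> T'"
    and conv: "\<And>t ts. t \<in> {0..T'} \<Longrightarrow> (\<And>i. 0 \<le> ts i) \<Longrightarrow> (\<And>i. ts i \<le> Ts i) \<Longrightarrow> ts \<longlonglongrightarrow> t \<Longrightarrow>
      (\<lambda>i. zs i (ts i)) \<longlonglongrightarrow> z t"
  shows "graph_converges Ts zs T' z"
  unfolding graph_converges_def PK_converges_def
proof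
  show "graph_of T' z \<subseteq> inner_limit (\<lambda>i. graph_of (Ts i) (zs i))"
  proof
    fix q assume "q \<in> graph_of T' z"
    then obtain t where q: "q = (t, z t)" and t: "t \<in> {0..T'}" unfolding graph_of_def by blast
    let ?ts = "\<lambda>i. min t (Ts i)"
    have lim: "?ts \<longlonglongrightarrow> t" using tendsto_min[OF tendsto_const[of t] Ts(2)] t by (simp add: min_def)
    have "(\<lambda>i. (?ts i, zs i (?ts i))) \<longlonglongrightarrow> (t, z t)"
      using t Ts(1) by (intro tendsto_Pair lim conv) auto
    moreover have "\<forall>\<^sub>F i in sequentially. (?ts i, zs i (?ts i)) \<in> graph_of (Ts i) (zs i)"
      unfolding graph_of_def using t Ts(1) by (intro always_eventually) auto
    ultimately show "q \<in> inner_limit (\<lambda>i. graph_of (Ts i) (zs i))"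
      unfolding inner_limit_def q mem_Collect_eq
      by (intro exI[of _ "\<lambda>i. (?ts i, zs i (?ts i))"] conjI)
  qed
  show "outer_limit (\<lambda>i. graph_of (Ts i) (zs i)) \<subseteq> graph_of T' z"
  proof
    fix q assume "q \<in> outer_limit (\<lambda>i. graph_of (Ts i) (zs i))"
    then obtain r qs where r: "strict_mono r" and qs: "\<And>k. qs k \<in> graph_of (Ts (r k)) (zs (r k))" and lim: "qs \<longlonglongrightarrow> q"
      unfolding outer_limit_def by blast
    define ts where "ts k = fst (qs k)" for k
    have ts: "ts k \<in> {0..Ts (r k)}" "qs k = (ts k, zs (r k) (ts k))" for k
      using qs[of k] by (auto simp: graph_of_def ts_def)
    have tlim: "ts \<longlonglongrightarrow> fst q" unfolding ts_def[abs_def] by (intro tendsto_fst lim)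
    have "(\<lambda>k. Ts (r k)) \<longlonglongrightarrow> T'" using LIMSEQ_subseq_LIMSEQ[OF Ts(2) r] by (simp add: o_def)
    then have fq: "fst q \<in> {0..T'}"
      using tlim ts(1) by (auto intro: LIMSEQ_le LIMSEQ_le_const)
    text \<open>The times along the subsequence are completed to a full sequence of admissible times.\<close>
    define us where "us i = (if i \<in> range r then ts (inv r i) else min (fst q) (Ts i))" for i
    have inj: "inj r" using r by (rule strict_mono_imp_inj_on)
    have us_r: "us (r k) = ts k" for k by (simp add: us_def inv_f_f[OF inj])
    have us: "0 \<le> us i" "us i \<le> Ts i" for i
      using ts(1) fq Ts(1)[of i] by (auto simp: us_def inv_f_f[OF inj])
    have "us \<longlonglongrightarrow> fst q"
    proof (rule tendstoI)
      fix e :: real assume e: "e > 0"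
      have mlim: "(\<lambda>i. min (fst q) (Ts i)) \<longlonglongrightarrow> fst q"
        using tendsto_min[OF tendsto_const[of "fst q"] Ts(2)] fq by (simp add: min_def)
      obtain N1 where N1: "\<And>k. k \<ge> N1 \<Longrightarrow> dist (ts k) (fst q) < e"
        using tlim e unfolding lim_sequentially by blast
      obtain N2 where N2: "\<And>i. i \<ge> N2 \<Longrightarrow> dist (min (fst q) (Ts i)) (fst q) < e"
        using mlim e unfolding lim_sequentially by blast
      have "dist (us i) (fst q) < e" if i: "i \<ge> max N2 (r N1)" for i
      proof (cases "i \<in> range r")
        case True
        then obtain k where k: "i = r k" by blast
        then have "r N1 \<le> r k" using i by simp
        then have "N1 \<le> k" using r by (simp add: strict_mono_less_eq)
        then show ?thesis using N1 us_r k by simp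
      next
        case False
        then show ?thesis using N2 i by (simp add: us_def)
      qed
      then show "\<forall>\<^sub>F i in sequentially. dist (us i) (fst q) < e" unfolding eventually_sequentially by blast
    qed
    with fq us have "(\<lambda>i. zs i (us i)) \<longlonglongrightarrow> z (fst q)" by (intro conv)
    from LIMSEQ_subseq_LIMSEQ[OF this r] have "(\<lambda>k. zs (r k) (ts k)) \<longlonglongrightarrow> z (fst q)"
      by (simp add: o_def us_r)
    moreover have "(\<lambda>k. zs (r k) (ts k)) \<longlonglongrightarrow> snd q"
    proof -
      have "zs (r k) (ts k) = snd (qs k)" for k using ts(2)[of k] by simp
      with tendsto_snd[OF lim] show ?thesis by simp
    qed
    ultimately have "snd q = z (fst q)" using LIMSEQ_unique by blast
    with fq show "q \<in> graph_of T' z" unfolding graph_of_def by (cases q) auto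
  qed
qed

section \<open>Compactness of the trajectories and identification of the limit\<close>

theorem theorem4p5:
  fixes Z :: "(real^'n) set"
    and f :: "real^'n \<Rightarrow> real^'n \<Rightarrow> real^'n"
    and G :: "real^'n \<Rightarrow> real^'n^'n"
    and z0 :: "real^'n"
    and M \<nu> \<mu> \<alpha> \<epsilon> T :: real
    and K :: "nat \<Rightarrow> real"
    and Ts :: "nat \<Rightarrow> real"
    and zs :: "nat \<Rightarrow> real \<Rightarrow> real^'n"
  assumes Z_closed: "closed Z"
    and Z_regular: "clarke_regular Z"
    and f_cont: "continuous_on (UNIV \<times> Z) (\<lambda>(z, p). f z p)"
    and G_cont: "continuous_on Z G"
    and G_spd: "\<forall>x\<in>Z. sym_pos_def (G x)"
    and z0_in: "z0 \<in> Z"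
    and pos: "M > 0" "\<nu> > 0" "\<mu> > 0" "\<alpha> > 0" "\<epsilon> > 0"
    and bound_f: "\<forall>z\<in>cball z0 \<epsilon> \<inter> inflated Z \<alpha>. \<forall>p\<in>proj_set Z z. norm (f z p) \<le> M"
    and bound_G: "\<forall>z\<in>cball z0 \<epsilon> \<inter> inflated Z \<alpha>. \<forall>p\<in>proj_set Z z.
                    loewner_le (\<mu> *\<^sub>R mat 1) (matrix_inv (G p)) \<and>
                    loewner_le (matrix_inv (G p)) (\<nu> *\<^sub>R mat 1)"
    and prox: "\<forall>z\<in>cball z0 \<epsilon> \<inter> Z. prox_regular_at Z \<alpha> z"
    and T_pos: "T > 0"
    and K_pos: "\<forall>i. K i > 0"
    and K_lim: "K \<longlonglongrightarrow> 0"
    and sols: "\<forall>i. truncated_sol (anti_windup Z f G (K i)) T \<epsilon> z0 (Ts i) (zs i)"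
  shows "\<exists>r T' z. strict_mono r \<and>
           truncated_sol (pds_rhs Z f G) T \<epsilon> z0 T' z \<and>
           graph_converges (Ts \<circ> r) (zs \<circ> r) T' z"
proof -
  interpret anti_windup_bounds Z f G z0 M \<nu> \<mu> \<alpha> \<epsilon>
    by unfold_locales (fact G_spd z0_in pos bound_f bound_G)+
  define L where "L = M + \<nu> * M / \<mu>"
  have L: "L > 0" using pos by (simp add: L_def add_pos_pos)
  \<comment> \<open>Each trajectory is frozen after its stopping time, so that all live on
    \<open>{0..T}\<close>; \<open>clamp\<close> is nonexpansive and preserves the Lipschitz
    constant.\<close>
  define clamp where "clamp c s = max 0 (min s c)" for c s :: real
  have clamp_diff: "\<bar>clamp c t - clamp c s\<bar> \<le> \<bar>t - s\<bar>" for c s t by (auto simp: clamp_def)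
  have clamp_in: "clamp c s \<in> {0..c}" if "0 \<le> c" for c s using that by (auto simp: clamp_def)
  have clamp_id: "clamp c s = s" if "s \<in> {0..c}" for c s using that by (auto simp: clamp_def)
  have Ts: "0 \<le> Ts i" "Ts i \<le> T" for i
    using sols by (auto simp: truncated_sol_def caratheodory_sol_def)

  have "(\<lambda>i. K i * M / \<mu>) \<longlonglongrightarrow> 0 * M / \<mu>" using pos by (intro tendsto_intros K_lim) auto
  then have "\<forall>\<^sub>F i in sequentially. K i * M / \<mu> < 1 / (2 * \<alpha>)" by (rule order_tendstoD) (use pos in simp)
  \<comment> \<open>The trajectory estimates are invoked only where \<open>K i * M / \<mu>\<close>
    is below the tube radius, so the first \<open>N\<close> indices are dropped and the shift
    returns in \<open>r\<close>.\<close>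
  then obtain N where N: "\<And>i. i \<ge> N \<Longrightarrow> K i * M / \<mu> < 1 / (2 * \<alpha>)" unfolding eventually_sequentially by blast
  define Y where "Y i s = zs (i + N) (clamp (Ts (i + N)) s)" for i s
  have lipschitz_sol: "norm (zs i t - zs i s) \<le> L * \<bar>t - s\<bar>" if "i \<ge> N" "s \<in> {0..Ts i}" "t \<in> {0..Ts i}" for i s t
    using truncated_sol_lipschitz[OF K_pos[rule_format] sols[rule_format] N[OF that(1)], of s t]
      truncated_sol_lipschitz[OF K_pos[rule_format] sols[rule_format] N[OF that(1)], of t s] that
    by (cases "s \<le> t") (auto simp: L_def norm_minus_commute)
  have Y_lip: "norm (Y i t - Y i s) \<le> L * \<bar>t - s\<bar>" for i s t
  proof -
    have "norm (Y i t - Y i s) \<le> L * \<bar>clamp (Ts (i + N)) t - clamp (Ts (i + N)) s\<bar>"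
      unfolding Y_def by (intro lipschitz_sol clamp_in Ts) simp
    also have "\<dots> \<le> L * \<bar>t - s\<bar>" using clamp_diff L by (intro mult_left_mono) auto
    finally show ?thesis .
  qed
  have Y_ball: "Y i s \<in> cball z0 \<epsilon>" for i s
    using sols clamp_in[OF Ts(1)] unfolding Y_def truncated_sol_def by blast
  have Y_bound: "norm (Y i s) \<le> norm z0 + \<epsilon>" for i s
    using Y_ball[of i s] norm_triangle_sub[of "Y i s" z0] by (simp add: dist_norm norm_minus_commute)

  have "\<forall>i. Ts (i + N) \<in> {0..T}" using Ts by simp
  with compact_Icc[of 0 T] obtain T' k1 where k1: "strict_mono (k1 :: nat \<Rightarrow> nat)"
    and T'0: "T' \<in> {0..T}" and lim1: "((\<lambda>i. Ts (i + N)) \<circ> k1) \<longlonglongrightarrow> T'"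
    unfolding compact_def by metis
  from lipschitz_Arzela_Ascoli[of T "\<lambda>i. Y (k1 i)", OF Y_bound Y_lip]
  obtain g k2 where k2: "strict_mono (k2 :: nat \<Rightarrow> nat)" and
    lim2: "\<forall>s\<in>{0..T}. (\<lambda>i. Y (k1 (k2 i)) s) \<longlonglongrightarrow> g s" by (elim exE conjE)
  define r where "r i = k1 (k2 i) + N" for i
  have r: "strict_mono r" using k1 k2 by (auto simp: r_def strict_mono_def)
  have rN: "r i \<ge> N" for i by (simp add: r_def)
  have T_lim: "(\<lambda>i. Ts (r i)) \<longlonglongrightarrow> T'"
    using LIMSEQ_subseq_LIMSEQ[OF lim1 k2] by (simp add: o_def r_def)
  have g_lim: "(\<lambda>i. zs (r i) (clamp (Ts (r i)) s)) \<longlonglongrightarrow> g s" if "s \<in> {0..T}" for s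
    using lim2[rule_format, OF that] by (simp add: Y_def r_def)
  have K_lim': "(\<lambda>i. K (r i)) \<longlonglongrightarrow> 0" using LIMSEQ_subseq_LIMSEQ[OF K_lim r] by (simp add: o_def)
  have conv: "(\<lambda>i. zs (r i) (ts i)) \<longlonglongrightarrow> g t"
    if t: "t \<in> {0..T'}" and ts: "\<And>i. 0 \<le> ts i" "\<And>i. ts i \<le> Ts (r i)" "ts \<longlonglongrightarrow> t" for t ts
  proof -
    \<comment> \<open>Time \<open>t\<close> may exceed \<open>Ts (r i)\<close>; the comparison is
      with the clamped time, which is no farther from \<open>ts i\<close> than \<open>t\<close>
      is.\<close>
    have "(\<lambda>i. zs (r i) (ts i) - zs (r i) (clamp (Ts (r i)) t)) \<longlonglongrightarrow> 0"
    proof (rule Lim_null_comparison)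
      have "norm (zs (r i) (ts i) - zs (r i) (clamp (Ts (r i)) t)) \<le> L * \<bar>ts i - t\<bar>" for i
      proof -
        have "norm (zs (r i) (ts i) - zs (r i) (clamp (Ts (r i)) t)) \<le> L * \<bar>ts i - clamp (Ts (r i)) t\<bar>"
          using ts(1,2) by (intro lipschitz_sol rN clamp_in Ts) auto
        also have "\<dots> = L * \<bar>clamp (Ts (r i)) (ts i) - clamp (Ts (r i)) t\<bar>"
          using ts(1,2) by (subst clamp_id[of "ts i"]) auto
        also have "\<dots> \<le> L * \<bar>ts i - t\<bar>" using clamp_diff L by (intro mult_left_mono) auto
        finally show ?thesis .
      qed
      then show "\<forall>\<^sub>F i in sequentially. norm (zs (r i) (ts i) - zs (r i) (clamp (Ts (r i)) t)) \<le> L * \<bar>ts i - t\<bar>"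
        by simp
      have "(\<lambda>i. L * \<bar>ts i - t\<bar>) \<longlonglongrightarrow> L * \<bar>t - t\<bar>" by (intro tendsto_intros ts(3))
      then show "(\<lambda>i. L * \<bar>ts i - t\<bar>) \<longlonglongrightarrow> 0" by simp
    qed
    moreover have "t \<in> {0..T}" using t T'0 by auto
    ultimately show ?thesis using tendsto_add[OF _ g_lim[of t]] by fastforce
  qed
  have g_lip: "norm (g t - g s) \<le> L * \<bar>t - s\<bar>" if "s \<in> {0..T}" "t \<in> {0..T}" for s t
  proof (rule tendsto_upperbound)
    show "(\<lambda>i. norm (Y (k1 (k2 i)) t - Y (k1 (k2 i)) s)) \<longlonglongrightarrow> norm (g t - g s)"
      by (intro tendsto_intros lim2[rule_format] that)
  qed (use Y_lip in auto)
  have g_Z: "g s \<in> Z" if "s \<in> {0..T'}" for s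
  proof -
    have sT: "s \<in> {0..T}" using that T'0 by auto
    have "(\<lambda>i. infdist (zs (r i) (clamp (Ts (r i)) s)) Z) \<longlonglongrightarrow> infdist (g s) Z"
      by (intro tendsto_infdist g_lim sT)
    moreover have "(\<lambda>i. K (r i) * M / \<mu>) \<longlonglongrightarrow> 0 * M / \<mu>" using pos by (intro tendsto_intros K_lim') auto
    moreover have "infdist (zs (r i) (clamp (Ts (r i)) s)) Z \<le> K (r i) * M / \<mu>" for i
      by (rule infdist_truncated_sol_le[OF K_pos[rule_format] sols[rule_format] N[OF rN] clamp_in[OF Ts(1)]])
    ultimately have "infdist (g s) Z \<le> 0 * M / \<mu>" by (intro LIMSEQ_le) auto
    then have "infdist (g s) Z = 0" using infdist_nonneg[of "g s" Z] by simp
    then show ?thesis using in_closed_iff_infdist_zero[OF Z_closed, of "g s"] z0_in by blast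
  qed
  have g_0: "g 0 = z0"
  proof -
    have "zs (r i) (clamp (Ts (r i)) 0) = z0" for i
      using sols Ts(1)[of "r i"] by (simp add: clamp_def truncated_sol_def)
    then have "(\<lambda>i. z0) \<longlonglongrightarrow> g 0" using g_lim[of 0] T_pos by simp
    then show ?thesis by (simp add: LIMSEQ_const_iff)
  qed
  have g_ball: "g s \<in> cball z0 \<epsilon>" if "s \<in> {0..T'}" for s
  proof -
    have "s \<in> {0..T}" using that T'0 by auto
    then show ?thesis using closed_sequentially[OF closed_cball Y_ball lim2[rule_format]] by blast
  qed
  \<comment> \<open>If the limit time falls short of \<open>T\<close>, so do the stopping times
    eventually, and the trajectories end on the sphere; convergence along the moving endpoints
    carries this over.\<close>
  have g_end: "T' = T \<or> norm (g T' - z0) = \<epsilon>"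
  proof (cases "T' = T")
    case False
    then have "T' < T" using T'0 by auto
    then have "\<forall>\<^sub>F i in sequentially. Ts (r i) < T" using T_lim by (intro order_tendstoD) auto
    then have "\<forall>\<^sub>F i in sequentially. norm (zs (r i) (Ts (r i)) - z0) = \<epsilon>"
      by eventually_elim (use sols in \<open>auto simp: truncated_sol_def\<close>)
    moreover have "(\<lambda>i. norm (zs (r i) (Ts (r i)) - z0)) \<longlonglongrightarrow> norm (g T' - z0)"
      using T'0 Ts by (intro tendsto_intros conv T_lim) auto
    ultimately have "(\<lambda>i. \<epsilon>) \<longlonglongrightarrow> norm (g T' - z0)"
      by (rule Lim_transform_eventually[rotated])
    then show ?thesis by (simp add: LIMSEQ_const_iff)
  qed simp

  have "caratheodory_sol (pds_rhs Z f G) T' g"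
    unfolding caratheodory_sol_def
  proof (intro conjI)
    show "0 \<le> T'" using T'0 by simp
    show "abs_continuous_on_interval 0 T' g"
    proof (rule lipschitz_imp_abs_continuous_on_interval)
      show "norm (g t - g s) \<le> L * (t - s)" if "0 \<le> s" "s \<le> t" "t \<le> T'" for s t
        using g_lip[of s t] that T'0 by auto
    qed
    \<comment> \<open>The differentiability lemma concerns functions on the whole line, so
      \<open>g\<close> is extended by constants; the two endpoints are discarded below as null,
      since the tangent argument approaches \<open>t\<close> from both sides.\<close>
    define h where "h s = g (clamp T' s)" for s
    have h_eq: "h s = g s" if "s \<in> {0..T'}" for s using clamp_id[OF that] by (simp add: h_def)
    have "AE t in lborel. h differentiable (at t)"
    proof (rule lipschitz_vec_differentiable_AE)
      fix s t :: real assume st: "s \<le> t"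
      have "norm (h t - h s) \<le> L * \<bar>clamp T' t - clamp T' s\<bar>"
        unfolding h_def using T'0 by (intro g_lip) (auto simp: clamp_def)
      also have "\<dots> \<le> L * \<bar>t - s\<bar>" using clamp_diff L by (intro mult_left_mono) auto
      finally show "norm (h t - h s) \<le> L * (t - s)" using st by simp
    qed
    then show "AE t in lborel. t \<in> {0..T'} \<longrightarrow>
        (\<exists>v. (g has_vector_derivative v) (at t within {0..T'}) \<and> v \<in> pds_rhs Z f G (g t))"
      using AE_lborel_singleton[of 0] AE_lborel_singleton[of T']
    proof eventually_elim
      case (elim t)
      show ?case
      proof
        assume tT: "t \<in> {0..T'}"
        then have t: "0 < t" "t < T'" using elim by auto
        obtain v where v: "(h has_vector_derivative v) (at t)"
          using elim by (auto simp: vector_derivative_works)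
        have v': "(g has_vector_derivative v) (at t within {0..T'})"
          by (rule has_vector_derivative_transform[OF tT _ has_vector_derivative_at_within[OF v]]) (simp add: h_eq)
        have gZ: "g t \<in> Z" by (rule g_Z[OF tT])
        have tan: "v \<in> tangent_cone Z (g t)" "- v \<in> tangent_cone Z (g t)"
          using tangent_cone_vector_derivative[OF t _ v, of Z] g_Z h_eq tT by auto
        have normal: "(f (g t) (g t) - v) \<bullet> (G (g t) *v w) \<le> 0" if w: "w \<in> tangent_cone Z (g t)" for w
        proof -
          define h0 where "h0 = (T' - t) / 2"
          have h0: "h0 > 0" "t + h0 < T'" using t by (auto simp: h0_def field_simps)
          have "\<forall>\<^sub>F i in sequentially. t + h0 < Ts (r i)" using T_lim h0(2) by (rule order_tendstoD)
          then have long: "\<forall>\<^sub>F i in sequentially. t + h0 \<le> Ts (r i)" by eventually_elim simp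
          have "(f (h t) (h t) - v) \<bullet> (G (h t) *v w) \<le> 0"
          proof (rule limit_velocity_normal[OF Z_regular f_cont G_cont, where K = "\<lambda>i. K (r i)"
                and Ts = "\<lambda>i. Ts (r i)" and zs = "\<lambda>i. zs (r i)", OF _ K_lim' N[OF rN] _ _ h0(1) long _ v])
            fix s assume s: "s \<in> {t..t + h0}"
            have sT: "s \<in> {0..T'}" using s t h0 by auto
            have "\<forall>\<^sub>F i in sequentially. zs (r i) (clamp (Ts (r i)) s) = zs (r i) s"
              using long
            proof eventually_elim
              case (elim i)
              then show ?case using s t by (subst clamp_id) auto
            qed
            moreover have "(\<lambda>i. zs (r i) (clamp (Ts (r i)) s)) \<longlonglongrightarrow> h s"
              using g_lim[of s] sT T'0 by (simp add: h_eq)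
            ultimately show "(\<lambda>i. zs (r i) s) \<longlonglongrightarrow> h s" by (rule Lim_transform_eventually[rotated])
          qed (use K_pos sols t gZ w tT h_eq in auto)
          then show ?thesis using h_eq[OF tT] by simp
        qed
        have "v \<in> proj_op Z G (f (g t) (g t)) (g t)"
          using G_spd gZ tan normal by (intro proj_op_characterization) auto
        \<comment> \<open>A point of \<open>Z\<close> is its own projection, which is the witness
          for the existential in \<open>pds_rhs\<close>.\<close>
        then have "v \<in> pds_rhs Z f G (g t)"
          unfolding pds_rhs_def using gZ proj_set_self[OF gZ] by blast
        with v' show "\<exists>v. (g has_vector_derivative v) (at t within {0..T'}) \<and> v \<in> pds_rhs Z f G (g t)" by blast
      qed
    qed
  qed
  then have "truncated_sol (pds_rhs Z f G) T \<epsilon> z0 T' g"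
    unfolding truncated_sol_def using g_0 g_ball g_end T'0 by auto
  moreover have "graph_converges (Ts \<circ> r) (zs \<circ> r) T' g"
    using Ts(1) T_lim conv by (intro graph_converges_if_convergent_along_times) (auto simp: o_def)
  ultimately show ?thesis using r by blast
qed

end
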